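(* Let $\Lambda,\Omega$ be countably infinite sets and let $\rho:\mathcal{F}\to[\Lambda]^\omega$ be a partition regular function with $\mathcal{F}\subseteq[\Omega]^\omega$. (1) $\mathrm{FinBW}(\rho)$ contains all finite spaces and is a subclass of the class of all sequentially compact spaces. (2) $\rho$ is not tall if and only if $\mathrm{FinBW}(\rho)$ coincides with the class of all sequentially compact spaces. (3) The following conditions are equivalent: (a) $\rho$ is $P^-(\Lambda)$; (b) there are Hausdorff compact spaces of arbitrary cardinality that belong to $\mathrm{FinBW}(\rho)$; (c) there exists an infinite Hausdorff topological space $X\in\mathrm{FinBW}(\rho)$. (4) The following conditions are equivalent: (a) $\rho$ is $P^-$; (b) there are Hausdorff compact spaces of arbitrary cardinality that belong to $\mathrm{hFinBW}(\rho)$; (c) there exists an infinite Hausdorff topological space $X\in\mathrm{hFinBW}(\rho)$. (5) If $\rho$ is $P^-$, then (a) the uncountable non-compact Hausdorff space $X=\omega_1$ with the order topology belongs to $\mathrm{FinBW}(\rho)$; (b) assuming the Continuum Hypothesis, there are Hausdorff compact and separable spaces of cardinality $\mathfrak{c}$ that belong to $\mathrm{FinBW}(\rho)$. (6) If $\rho$ is weak $P^+$, then every compact metric space is in $\mathrm{hFinBW}(\rho)$. (7) If $\rho$ is $P^+$, then every Hausdorff topological space with the property $( * )$ belongs to $\mathrm{hFinBW}(\rho)$, where a topological space $X$ has property $( * )$ if for every countable set $D\subseteq X$ the closure of $D$ in $X$ is compact and first-countable.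
   Context: $[A]^\omega$ is the family of infinite countable subsets of $A$, $[A]^{<\omega}$ the family of finite subsets of $A$. Partition regular functions: let $\Lambda,\Omega$ be countably infinite, and let $\mathcal{F}$ be a nonempty family of infinite subsets of $\Omega$ such that $F\setminus K\in\mathcal{F}$ for all $F\in\mathcal{F}$ and finite $K\subseteq\Omega$. A function $\rho:\mathcal{F}\to[\Lambda]^\omega$ is partition regular if (M) for all $E,F\in\mathcal{F}$, $E\subseteq F$ implies $\rho(E)\subseteq\rho(F)$; (R) for all $F\in\mathcal{F}$ and $A,B\subseteq\Lambda$ with $\rho(F)=A\cup B$ there is $E\in\mathcal{F}$ with $\rho(E)\subseteq A$ or $\rho(E)\subseteq B$; (S) for every $F\in\mathcal{F}$ there is $E\in\mathcal{F}$ with $E\subseteq F$ such that for every $a\in\rho(E)$ there is a finite $K\subseteq\Omega$ with $a\notin\rho(E\setminus K)$. Put $\mathcal{I}_\rho=\{A\subseteq\Lambda:\forall F\in\mathcal{F}\ \rho(F)\not\subseteq A\}$ (this is an ideal on $\Lambda$) and $\mathcal{I}_\rho^+=\mathcal{P}(\Lambda)\setminus\mathcal{I}_\rho$. $\rho$ is tall if every infinite $A\subseteq\Lambda$ contains an infinite $B\subseteq A$ with $B\in\mathcal{I}_\rho$. For $F\in\mathcal{F}$ and $B\subseteq\Lambda$ write $\rho(F)\subseteq^\rho B$ if there is a finite $K\subseteq\Omega$ with $\rho(F\setminus K)\subseteq B$ (a relation between $F$ and $B$). $\rho$ is $P^+$ if for every $\subseteq$-decreasing sequence $(A_n)_{n\in\omega}$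 in $\mathcal{I}_\rho^+$ there is $F\in\mathcal{F}$ with $\rho(F)\subseteq^\rho A_n$ for all $n$. $\rho$ is $P^-$ if the same holds for all $\subseteq$-decreasing sequences $(A_n)$ in $\mathcal{I}_\rho^+$ with $A_n\setminus A_{n+1}\in\mathcal{I}_\rho$ for all $n$. $\rho$ is $P^-(\Lambda)$ if the same holds for all such sequences (i.e. with $A_n\setminus A_{n+1}\in\mathcal{I}_\rho$) with additionally $A_0=\Lambda$. $\rho$ is weak $P^+$ if for every $E\in\mathcal{F}$ there is $F\in\mathcal{F}$ with $\rho(F)\subseteq\rho(E)$ such that for every sequence $(F_n)_{n\in\omega}$ in $\mathcal{F}$ with $\rho(F)\supseteq\rho(F_n)\supseteq\rho(F_{n+1})$ for all $n$ there is $G\in\mathcal{F}$ with $\rho(G)\subseteq^\rho\rho(F_n)$ for all $n$. For $F\in\mathcal{F}$, a function $f:\rho(F)\to X$ into a topological space $X$ is $\rho$-convergent to $x\in X$ if for every neighbourhood $U$ of $x$ there is a finite $K\subseteq\Omega$ with $f[\rho(F\setminus K)]\subseteq U$; "$f\restriction\rho(F)$ $\rho$-converges" means $\rho$-convergent to some point. $\mathrm{FinBW}(\rho)$ is the class of all topological spaces $X$ such that for every $f:\Lambda\to X$ there is $F\in\mathcal{F}$ such that $f\restriction\rho(F)$ $\rho$-converges. $\mathrm{hFinBW}(\rho)$ is the class of all topological spaces $X$ such that for every $E\in\mathcal{F}$ and every $f:\rho(E)\to X$ there is $F\in\mathcal{F}$ with $\rho(F)\subseteq\rho(E)$ such that $f\restriction\rho(F)$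 $\rho$-converges. *)

theory Defs
  imports "HOL-Analysis.Analysis"
begin

text \<open>A function \<open>\<rho>\<close> defined on the family \<open>\<F>\<close> is represented by a total function
  on \<open>'o set\<close>; only its values on members of \<open>\<F>\<close> are ever used.\<close>

definition partition_regular ::
    "'l set \<Rightarrow> 'o set \<Rightarrow> 'o set set \<Rightarrow> ('o set \<Rightarrow> 'l set) \<Rightarrow> bool" where
  "partition_regular \<Lambda> \<Omega> \<F> \<rho> \<longleftrightarrow>
     countable \<Lambda> \<and> infinite \<Lambda> \<and> countable \<Omega> \<and> infinite \<Omega> \<and>
     \<F> \<noteq> {} \<and> (\<forall>F\<in>\<F>. F \<subseteq> \<Omega> \<and> infinite F) \<and>
     (\<forall>F\<in>\<F>. \<forall>K. finite K \<and> K \<subseteq> \<Omega> \<longrightarrow> F - K \<in> \<F>) \<and>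
     (\<forall>F\<in>\<F>. \<rho> F \<subseteq> \<Lambda> \<and> infinite (\<rho> F)) \<and>
     (\<forall>E\<in>\<F>. \<forall>F\<in>\<F>. E \<subseteq> F \<longrightarrow> \<rho> E \<subseteq> \<rho> F) \<and>
     (\<forall>F\<in>\<F>. \<forall>A B. A \<subseteq> \<Lambda> \<and> B \<subseteq> \<Lambda> \<and> \<rho> F = A \<union> B \<longrightarrow>
        (\<exists>E\<in>\<F>. \<rho> E \<subseteq> A \<or> \<rho> E \<subseteq> B)) \<and>
     (\<forall>F\<in>\<F>. \<exists>E\<in>\<F>. E \<subseteq> F \<and>
        (\<forall>a\<in>\<rho> E. \<exists>K. finite K \<and> K \<subseteq> \<Omega> \<and> a \<notin> \<rho> (E - K)))"

definition rho_ideal :: "'l set \<Rightarrow> 'o set set \<Rightarrow> ('o set \<Rightarrow> 'l set) \<Rightarrow> 'l set set" where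
  "rho_ideal \<Lambda> \<F> \<rho> = {A. A \<subseteq> \<Lambda> \<and> (\<forall>F\<in>\<F>. \<not> \<rho> F \<subseteq> A)}"

definition rho_positive :: "'l set \<Rightarrow> 'o set set \<Rightarrow> ('o set \<Rightarrow> 'l set) \<Rightarrow> 'l set set" where
  "rho_positive \<Lambda> \<F> \<rho> = Pow \<Lambda> - rho_ideal \<Lambda> \<F> \<rho>"

definition tall :: "'l set \<Rightarrow> 'o set set \<Rightarrow> ('o set \<Rightarrow> 'l set) \<Rightarrow> bool" where
  "tall \<Lambda> \<F> \<rho> \<longleftrightarrow>
     (\<forall>A. A \<subseteq> \<Lambda> \<and> infinite A \<longrightarrow> (\<exists>B. B \<subseteq> A \<and> infinite B \<and> B \<in> rho_ideal \<Lambda> \<F> \<rho>))"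

definition rho_almost_subset ::
    "'o set \<Rightarrow> ('o set \<Rightarrow> 'l set) \<Rightarrow> 'o set \<Rightarrow> 'l set \<Rightarrow> bool" where
  "rho_almost_subset \<Omega> \<rho> F B \<longleftrightarrow> (\<exists>K. finite K \<and> K \<subseteq> \<Omega> \<and> \<rho> (F - K) \<subseteq> B)"

definition P_plus ::
    "'l set \<Rightarrow> 'o set \<Rightarrow> 'o set set \<Rightarrow> ('o set \<Rightarrow> 'l set) \<Rightarrow> bool" where
  "P_plus \<Lambda> \<Omega> \<F> \<rho> \<longleftrightarrow>
     (\<forall>A :: nat \<Rightarrow> 'l set.
        (\<forall>n. A n \<in> rho_positive \<Lambda> \<F> \<rho>) \<and> decseq A \<longrightarrow>
        (\<exists>F\<in>\<F>. \<forall>n. rho_almost_subset \<Omega> \<rho> F (A n)))"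

definition P_minus ::
    "'l set \<Rightarrow> 'o set \<Rightarrow> 'o set set \<Rightarrow> ('o set \<Rightarrow> 'l set) \<Rightarrow> bool" where
  "P_minus \<Lambda> \<Omega> \<F> \<rho> \<longleftrightarrow>
     (\<forall>A :: nat \<Rightarrow> 'l set.
        (\<forall>n. A n \<in> rho_positive \<Lambda> \<F> \<rho>) \<and> decseq A \<and>
        (\<forall>n. A n - A (Suc n) \<in> rho_ideal \<Lambda> \<F> \<rho>) \<longrightarrow>
        (\<exists>F\<in>\<F>. \<forall>n. rho_almost_subset \<Omega> \<rho> F (A n)))"

definition P_minus_Lambda ::
    "'l set \<Rightarrow> 'o set \<Rightarrow> 'o set set \<Rightarrow> ('o set \<Rightarrow> 'l set) \<Rightarrow> bool" where
  "P_minus_Lambda \<Lambda> \<Omega> \<F> \<rho> \<longleftrightarrow>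
     (\<forall>A :: nat \<Rightarrow> 'l set.
        (\<forall>n. A n \<in> rho_positive \<Lambda> \<F> \<rho>) \<and> decseq A \<and>
        (\<forall>n. A n - A (Suc n) \<in> rho_ideal \<Lambda> \<F> \<rho>) \<and> A 0 = \<Lambda> \<longrightarrow>
        (\<exists>F\<in>\<F>. \<forall>n. rho_almost_subset \<Omega> \<rho> F (A n)))"

definition weak_P_plus ::
    "'o set \<Rightarrow> 'o set set \<Rightarrow> ('o set \<Rightarrow> 'l set) \<Rightarrow> bool" where
  "weak_P_plus \<Omega> \<F> \<rho> \<longleftrightarrow>
     (\<forall>E\<in>\<F>. \<exists>F\<in>\<F>. \<rho> F \<subseteq> \<rho> E \<and>
        (\<forall>S :: nat \<Rightarrow> 'o set.
           (\<forall>n. S n \<in> \<F> \<and> \<rho> (S n) \<subseteq> \<rho> F \<and> \<rho> (S (Suc n)) \<subseteq> \<rho> (S n)) \<longrightarrow>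
           (\<exists>G\<in>\<F>. \<forall>n. rho_almost_subset \<Omega> \<rho> G (\<rho> (S n)))))"

definition rho_convergent_to ::
    "'o set \<Rightarrow> ('o set \<Rightarrow> 'l set) \<Rightarrow> 'a topology \<Rightarrow> 'o set \<Rightarrow> ('l \<Rightarrow> 'a) \<Rightarrow> 'a \<Rightarrow> bool" where
  "rho_convergent_to \<Omega> \<rho> X F f x \<longleftrightarrow>
     x \<in> topspace X \<and>
     (\<forall>U. openin X U \<and> x \<in> U \<longrightarrow> (\<exists>K. finite K \<and> K \<subseteq> \<Omega> \<and> f ` \<rho> (F - K) \<subseteq> U))"

text \<open>HOL has no class of all topological spaces. \<open>FinBW\<close> and \<open>hFinBW\<close> are polymorphic in
  the type \<open>'a\<close>, and their instance at \<open>'a\<close> collects the members of the class whose points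
  are of type \<open>'a\<close>. A function on a subset of \<open>\<Lambda>\<close> is a total function restricted to it.\<close>

definition FinBW ::
    "'l set \<Rightarrow> 'o set \<Rightarrow> 'o set set \<Rightarrow> ('o set \<Rightarrow> 'l set) \<Rightarrow> 'a topology set" where
  "FinBW \<Lambda> \<Omega> \<F> \<rho> =
     {X. \<forall>f \<in> \<Lambda> \<rightarrow> topspace X. \<exists>F\<in>\<F>. \<exists>x. rho_convergent_to \<Omega> \<rho> X F f x}"

definition hFinBW ::
    "'o set \<Rightarrow> 'o set set \<Rightarrow> ('o set \<Rightarrow> 'l set) \<Rightarrow> 'a topology set" where
  "hFinBW \<Omega> \<F> \<rho> =
     {X. \<forall>E\<in>\<F>. \<forall>f \<in> \<rho> E \<rightarrow> topspace X.
           \<exists>F\<in>\<F>. \<rho> F \<subseteq> \<rho> E \<and> (\<exists>x. rho_convergent_to \<Omega> \<rho> X F f x)}"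

definition sequentially_compact_space :: "'a topology \<Rightarrow> bool" where
  "sequentially_compact_space X \<longleftrightarrow>
     (\<forall>s :: nat \<Rightarrow> 'a. range s \<subseteq> topspace X \<longrightarrow>
        (\<exists>r l. strict_mono r \<and> limitin X (s \<circ> r) l sequentially))"

definition order_topology_on :: "'a rel \<Rightarrow> 'a topology" where
  "order_topology_on r =
     topology_generated_by
       ({Field r} \<union> underS r ` Field r \<union> aboveS r ` Field r)"

text \<open>The relation \<open>cardSuc natLeq\<close> is a well-order whose order type is the least uncountable
  ordinal.\<close>

definition omega1_space :: "nat set topology" where
  "omega1_space = order_topology_on (cardSuc natLeq)"

definition continuum_hypothesis :: bool where
  "continuum_hypothesis \<longleftrightarrow>
     (\<forall>A :: real set. countable A \<or> A \<approx> (UNIV :: real set))"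

definition property_star :: "'a topology \<Rightarrow> bool" where
  "property_star X \<longleftrightarrow>
     (\<forall>D. countable D \<and> D \<subseteq> topspace X \<longrightarrow>
        compactin X (X closure_of D) \<and> first_countable (subtopology X (X closure_of D)))"

end

theory Submission
  imports Defs "HOL-Library.Countable_Set_Type"
begin

text \<open>A set is positive when it contains some \<open>\<rho> F\<close>, and \<open>P\<^sup>-\<close> says that a positive set \<open>B\<close> contains
  some \<open>\<rho> F\<close> that escapes, after removing a finite set from \<open>F\<close>, each of countably many sets null in \<open>B\<close>.

  A tall \<open>\<rho>\<close> is separated from sequential compactness by the compactified Mrowka space of a maximal
  almost disjoint family of null sets. \<open>P\<^sup>-\<close> corresponds to the one-point compactifications of
  discrete spaces: fibres of a map are either positive or can all be escaped; conversely, an infinite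
  Hausdorff member of the class contains a nontrivial convergent sequence, which tests \<open>P\<^sup>-\<close>.
  On \<open>\<omega>\<^sub>1\<close> a map \<open>f\<close> converges to the least \<open>a\<close> such that \<open>f \<le> a\<close> on a positive set.

  Under CH the same argument is run on a compactification of \<open>\<omega>\<close> with remainder \<open>\<omega>\<^sub>1 + 1\<close>, given by
  an almost increasing tower \<open>T a\<close> of subsets of \<open>\<omega>\<close>. The tower is built so that every map from a positive
  set to \<open>\<omega>\<close> sends a positive set into some \<open>T a\<close>: if \<open>P\<close> and \<open>Q\<close> are disjoint infinite sets almost disjoint
  from the tower so far, then one of \<open>- P\<close>, \<open>- Q\<close> has positive preimage and can be taken as the next step.\<close>

section \<open>Positive sets and sequential compactness\<close>

text \<open>A use of \<open>diagonal\<close> escapes only countably many null sets, and this bound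
  shapes the positive results. On a one-point compactification only the fibres over the countable
  image matter; below a point of \<open>\<omega>\<^sub>1\<close> there are only countably many
  smaller bounds. The top of the tower space breaks the pattern: its neighbourhoods omit finitely
  many blocks chosen from uncountably many. A map with null fibres for which every block has null
  preimage could only converge to that top, so the tower must catch every map in some block
  beforehand. This is where the Continuum Hypothesis enters: there are continuum many relations
  between \<open>\<Lambda>\<close> and \<omega>, and along \<open>\<omega>\<^sub>1\<close> each of
  them gets a stage of its own, while every stage still has only countably many predecessors, as the
  choice of \<open>P\<close> and \<open>Q\<close> demands.

  In the Mrowka argument maximality is first obtained among null sets only. Tallness puts a null
  infinite set into every infinite set, and so makes the family meet each infinite subset of
  \<open>\<Lambda>\<close> in an infinite set; this is exactly what sequential compactness asks
  for.\<close>

lemma infinite_sets_strict_mono_choice: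
  fixes A :: "nat \<Rightarrow> nat set"
  assumes "\<And>n. infinite (A n)"
  shows "\<exists>r. strict_mono r \<and> (\<forall>n. r n \<in> A n)"
proof -
  have "\<exists>r. \<forall>n. r n \<in> A n \<and> r n < r (Suc n)"
  proof (rule dependent_nat_choice)
    show "\<exists>x. x \<in> A 0"
      using assms[of 0] by (metis finite.emptyI ex_in_conv)
    show "\<exists>y. y \<in> A (Suc n) \<and> x < y" for x n
      using assms[of "Suc n"] by (metis infinite_nat_iff_unbounded)
  qed
  then show ?thesis
    by (metis strict_mono_Suc_iff)
qed

lemma limitin_enumerate:
  assumes "infinite N" "l \<in> topspace X"
    and "\<And>U. openin X U \<Longrightarrow> l \<in> U \<Longrightarrow> finite {i \<in> N. s i \<notin> U}"
  shows "\<exists>r :: nat \<Rightarrow> nat. strict_mono r \<and> limitin X (s \<circ> r) l sequentially"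
proof (intro exI conjI)
  show sm: "strict_mono (enumerate N)"
    using assms(1) by (rule strict_mono_enumerate)
  show "limitin X (s \<circ> enumerate N) l sequentially"
    unfolding limitin_def
  proof (intro conjI allI impI)
    fix U assume U: "openin X U \<and> l \<in> U"
    let ?J = "{i \<in> N. s i \<notin> U}"
    have "finite (enumerate N -` ?J)"
      using U assms(3) sm by (intro finite_vimageI) (auto simp: strict_mono_imp_inj_on)
    then have "finite {n. (s \<circ> enumerate N) n \<notin> U}"
      by (rule rev_finite_subset) (auto simp: enumerate_in_set[OF assms(1)])
    then show "\<forall>\<^sub>F n in sequentially. (s \<circ> enumerate N) n \<in> U"
      by (simp add: eventually_cofinite flip: cofinite_eq_sequentially)
  qed (use assms in auto)
qed

lemma finite_exceptions_limitin:
  assumes "limitin X s l sequentially" "openin X U" "l \<in> U"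
  shows "finite {n. s n \<notin> U}"
  using assms unfolding limitin_def
  by (simp add: eventually_cofinite flip: cofinite_eq_sequentially)

section \<open>Partition regular functions and positive sets\<close>

locale partition_regular_function =
  fixes \<Lambda> :: "'l set" and \<Omega> :: "'o set" and \<F> :: "'o set set"
    and \<rho> :: "'o set \<Rightarrow> 'l set"
  assumes pr: "partition_regular \<Lambda> \<Omega> \<F> \<rho>"
begin

lemma partition_regular_unfolded:
  "countable \<Lambda>" "infinite \<Lambda>" "countable \<Omega>" "infinite \<Omega>" "\<F> \<noteq> {}"
  "\<forall>F\<in>\<F>. \<forall>K. finite K \<and> K \<subseteq> \<Omega> \<longrightarrow> F - K \<in> \<F>"
  "\<forall>F\<in>\<F>. \<rho> F \<subseteq> \<Lambda> \<and> infinite (\<rho> F)"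
  "\<forall>E\<in>\<F>. \<forall>F\<in>\<F>. E \<subseteq> F \<longrightarrow> \<rho> E \<subseteq> \<rho> F"
  "\<forall>F\<in>\<F>. \<forall>A B. A \<subseteq> \<Lambda> \<and> B \<subseteq> \<Lambda> \<and> \<rho> F = A \<union> B \<longrightarrow>
    (\<exists>E\<in>\<F>. \<rho> E \<subseteq> A \<or> \<rho> E \<subseteq> B)"
  "\<forall>F\<in>\<F>. \<exists>E\<in>\<F>. E \<subseteq> F \<and> (\<forall>a\<in>\<rho> E. \<exists>K. finite K \<and> K \<subseteq> \<Omega> \<and> a \<notin> \<rho> (E - K))"
  using pr unfolding partition_regular_def by - (elim conjE, assumption)+

lemmas countable_Lambda = partition_regular_unfolded(1)
  and infinite_Lambda = partition_regular_unfolded(2)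
  and countable_Omega = partition_regular_unfolded(3)
  and infinite_Omega = partition_regular_unfolded(4)
  and family_nonempty = partition_regular_unfolded(5)
  and rho_sparse = partition_regular_unfolded(10)[rule_format]

lemma family_Diff: "F \<in> \<F> \<Longrightarrow> finite K \<Longrightarrow> K \<subseteq> \<Omega> \<Longrightarrow> F - K \<in> \<F>"
  using partition_regular_unfolded(6) by blast

lemma rho_subset: "F \<in> \<F> \<Longrightarrow> \<rho> F \<subseteq> \<Lambda>" and infinite_rho: "F \<in> \<F> \<Longrightarrow> infinite (\<rho> F)"
  using partition_regular_unfolded(7) by blast+

lemma rho_mono: "E \<in> \<F> \<Longrightarrow> F \<in> \<F> \<Longrightarrow> E \<subseteq> F \<Longrightarrow> \<rho> E \<subseteq> \<rho> F"
  using partition_regular_unfolded(8) by blast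

lemma rho_regular:
  "F \<in> \<F> \<Longrightarrow> A \<subseteq> \<Lambda> \<Longrightarrow> B \<subseteq> \<Lambda> \<Longrightarrow> \<rho> F = A \<union> B \<Longrightarrow> \<exists>E\<in>\<F>. \<rho> E \<subseteq> A \<or> \<rho> E \<subseteq> B"
  using partition_regular_unfolded(9) by metis

lemma rho_Diff_antimono:
  assumes "F \<in> \<F>" "finite L" "L \<subseteq> \<Omega>" "K \<subseteq> L"
  shows "\<rho> (F - L) \<subseteq> \<rho> (F - K)"
proof (rule rho_mono)
  show "F - K \<in> \<F>"
    using assms by (intro family_Diff) (auto intro: finite_subset)
  show "F - L \<in> \<F>"
    using assms by (intro family_Diff)
qed (use assms(4) in blast)

lemma rho_Diff_subset: "F \<in> \<F> \<Longrightarrow> finite K \<Longrightarrow> K \<subseteq> \<Omega> \<Longrightarrow> \<rho> (F - K) \<subseteq> \<rho> F"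
  using rho_Diff_antimono[of F K "{}"] by simp

text \<open>Since \<open>\<rho> (F - K)\<close> shrinks as \<open>K\<close> grows, the union of the
  finitely many witnesses serves all members of the family at once.\<close>

lemma uniform_escape:
  assumes F: "F \<in> \<F>" and fin: "finite \<C>"
    and esc: "\<And>C. C \<in> \<C> \<Longrightarrow> \<exists>K. finite K \<and> K \<subseteq> \<Omega> \<and> \<rho> (F - K) \<inter> C = {}"
  shows "\<exists>K. finite K \<and> K \<subseteq> \<Omega> \<and> \<rho> (F - K) \<inter> \<Union>\<C> = {}"
proof -
  obtain k where k: "\<And>C. C \<in> \<C> \<Longrightarrow> finite (k C) \<and> k C \<subseteq> \<Omega> \<and> \<rho> (F - k C) \<inter> C = {}"
    using esc by metis
  let ?K = "\<Union>(k ` \<C>)"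
  have K: "finite ?K" "?K \<subseteq> \<Omega>"
    using fin k by auto
  have "\<rho> (F - ?K) \<inter> C = {}" if "C \<in> \<C>" for C
    using rho_Diff_antimono[OF F K, of "k C"] k[OF that] that by blast
  then show ?thesis
    using K by blast
qed

text \<open>Condition (S) yields a \<open>K\<close> for each single point of
  \<open>\<rho> E\<close>, and points outside \<open>\<rho> E\<close> are avoided from the start;
  finite unions of such \<open>K\<close> do the rest.\<close>

lemma sparse_escape:
  assumes "F \<in> \<F>"
  obtains E where "E \<in> \<F>" "E \<subseteq> F"
    "\<And>C. finite C \<Longrightarrow> \<exists>K. finite K \<and> K \<subseteq> \<Omega> \<and> \<rho> (E - K) \<inter> C = {}"
proof -
  obtain E where E: "E \<in> \<F>" "E \<subseteq> F"
    and esc: "\<And>a. a \<in> \<rho> E \<Longrightarrow> \<exists>K. finite K \<and> K \<subseteq> \<Omega> \<and> a \<notin> \<rho> (E - K)"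
    using rho_sparse[OF assms] by blast
  have one: "\<exists>K. finite K \<and> K \<subseteq> \<Omega> \<and> \<rho> (E - K) \<inter> {a} = {}" for a
  proof (cases "a \<in> \<rho> E")
    case False
    then show ?thesis
      by (intro exI[of _ "{}"]) auto
  qed (use esc in blast)
  have "\<exists>K. finite K \<and> K \<subseteq> \<Omega> \<and> \<rho> (E - K) \<inter> C = {}" if "finite C" for C
  proof -
    have "\<exists>K. finite K \<and> K \<subseteq> \<Omega> \<and> \<rho> (E - K) \<inter> \<Union>((\<lambda>a. {a}) ` C) = {}"
      using that one by (intro uniform_escape[OF E(1)]) auto
    then show ?thesis
      by simp
  qed
  then show thesis
    using that E by blast
qed

text \<open>Positivity without the demand \<open>A \<subseteq> \<Lambda>\<close>, so that it is
  monotone and no carrier conditions accompany unions and intersections.\<close>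

definition pos :: "'l set \<Rightarrow> bool" where
  "pos A \<longleftrightarrow> (\<exists>F\<in>\<F>. \<rho> F \<subseteq> A)"

lemma rho_ideal_iff: "A \<in> rho_ideal \<Lambda> \<F> \<rho> \<longleftrightarrow> A \<subseteq> \<Lambda> \<and> \<not> pos A"
  by (auto simp: rho_ideal_def pos_def)

lemma rho_positive_iff: "A \<in> rho_positive \<Lambda> \<F> \<rho> \<longleftrightarrow> A \<subseteq> \<Lambda> \<and> pos A"
  by (auto simp: rho_positive_def rho_ideal_iff)

lemma pos_mono: "pos A \<Longrightarrow> A \<subseteq> B \<Longrightarrow> pos B"
  unfolding pos_def by blast

lemma pos_rho: "F \<in> \<F> \<Longrightarrow> pos (\<rho> F)"
  unfolding pos_def by blast

lemma pos_Lambda: "pos \<Lambda>"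
  using family_nonempty rho_subset unfolding pos_def by blast

lemma pos_Un:
  assumes "pos (A \<union> B)"
  shows "pos A \<or> pos B"
proof -
  obtain F where F: "F \<in> \<F>" "\<rho> F \<subseteq> A \<union> B"
    using assms unfolding pos_def by blast
  \<comment> \<open>Regularity splits only a set equal to \<open>\<rho> F\<close>, so both parts are
    first intersected with it.\<close>
  have "\<exists>E\<in>\<F>. \<rho> E \<subseteq> A \<inter> \<rho> F \<or> \<rho> E \<subseteq> B \<inter> \<rho> F"
    using F rho_subset[OF F(1)] by (intro rho_regular[OF F(1)]) auto
  then show ?thesis
    unfolding pos_def by blast
qed

lemma pos_finite_UN:
  assumes "finite I" "pos (\<Union>i\<in>I. A i)"
  shows "\<exists>i\<in>I. pos (A i)"
  using assms
proof (induction I rule: finite_induct)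
  case empty
  then show ?case
    using infinite_rho by (fastforce simp: pos_def)
next
  case (insert i I)
  then show ?case
    using pos_Un[of "A i" "\<Union>i\<in>I. A i"] by auto
qed

lemma pos_imp_infinite: "pos A \<Longrightarrow> infinite A"
  using infinite_rho unfolding pos_def by (meson finite_subset)

text \<open>The common form of both classes: \<open>B = \<Lambda>\<close> gives \<open>FinBW\<close>
  and \<open>B = \<rho> E\<close> gives \<open>hFinBW\<close>, so each argument about a space is
  carried out once.\<close>

definition BW_on :: "'l set \<Rightarrow> 'a topology \<Rightarrow> bool" where
  "BW_on B X \<longleftrightarrow>
    (\<forall>f \<in> B \<rightarrow> topspace X. \<exists>F\<in>\<F>. \<rho> F \<subseteq> B \<and> (\<exists>x. rho_convergent_to \<Omega> \<rho> X F f x))"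

lemma FinBW_iff: "X \<in> FinBW \<Lambda> \<Omega> \<F> \<rho> \<longleftrightarrow> BW_on \<Lambda> X"
  using rho_subset unfolding FinBW_def BW_on_def by fastforce

lemma hFinBW_iff: "X \<in> hFinBW \<Omega> \<F> \<rho> \<longleftrightarrow> (\<forall>E\<in>\<F>. BW_on (\<rho> E) X)"
  unfolding hFinBW_def BW_on_def by blast

lemma hFinBW_subset_FinBW: "X \<in> hFinBW \<Omega> \<F> \<rho> \<Longrightarrow> X \<in> FinBW \<Lambda> \<Omega> \<F> \<rho>"
proof -
  assume X: "X \<in> hFinBW \<Omega> \<F> \<rho>"
  obtain E where E: "E \<in> \<F>"
    using family_nonempty by blast
  show "X \<in> FinBW \<Lambda> \<Omega> \<F> \<rho>"
    unfolding FinBW_iff BW_on_def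
  proof
    fix f assume "f \<in> \<Lambda> \<rightarrow> topspace X"
    then have "f \<in> \<rho> E \<rightarrow> topspace X"
      using rho_subset[OF E] by auto
    then show "\<exists>F\<in>\<F>. \<rho> F \<subseteq> \<Lambda> \<and> (\<exists>x. rho_convergent_to \<Omega> \<rho> X F f x)"
      using X E rho_subset unfolding hFinBW_iff BW_on_def by metis
  qed
qed

text \<open>\<open>diagonal B\<close> is the property \<open>P\<^sup>-\<close> for the sequences starting at \<open>B\<close>, with the
  decreasing sequence replaced by the sequence of removed sets.\<close>

definition diagonal :: "'l set \<Rightarrow> bool" where
  "diagonal B \<longleftrightarrow>
    (\<forall>C :: nat \<Rightarrow> 'l set. (\<forall>n. \<not> pos (B \<inter> C n)) \<longrightarrow>
      (\<exists>F\<in>\<F>. \<rho> F \<subseteq> B \<and> (\<forall>n. \<exists>K. finite K \<and> K \<subseteq> \<Omega> \<and> \<rho> (F - K) \<inter> C n = {})))"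

text \<open>In this form the two properties of the statement differ only in the sets
  \<open>B\<close> they allow: all positive ones, or \<open>\<Lambda>\<close> alone.\<close>

definition P_from :: "'l set \<Rightarrow> bool" where
  "P_from B \<longleftrightarrow>
    (\<forall>A :: nat \<Rightarrow> 'l set.
        (\<forall>n. A n \<in> rho_positive \<Lambda> \<F> \<rho>) \<and> decseq A \<and>
        (\<forall>n. A n - A (Suc n) \<in> rho_ideal \<Lambda> \<F> \<rho>) \<and> A 0 = B \<longrightarrow>
        (\<exists>F\<in>\<F>. \<forall>n. rho_almost_subset \<Omega> \<rho> F (A n)))"

text \<open>The sets to escape are the complements \<open>- A n\<close>: what they cut off from
  \<open>B\<close> is a finite union of null differences.\<close>

lemma diagonal_imp_P_from:
  assumes "diagonal B"
  shows "P_from B"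
  unfolding P_from_def
proof (intro allI impI)
  fix A :: "nat \<Rightarrow> 'l set"
  assume A: "(\<forall>n. A n \<in> rho_positive \<Lambda> \<F> \<rho>) \<and> decseq A \<and>
    (\<forall>n. A n - A (Suc n) \<in> rho_ideal \<Lambda> \<F> \<rho>) \<and> A 0 = B"
  have "\<not> pos (B \<inter> - A n)" for n
  proof (induction n)
    case 0
    then show ?case
      using A pos_imp_infinite by fastforce
  next
    case (Suc n)
    have "B \<inter> - A (Suc n) \<subseteq> (B \<inter> - A n) \<union> (A n - A (Suc n))"
      by blast
    then show ?case
      using Suc A pos_Un pos_mono rho_ideal_iff by metis
  qed
  then obtain F where F: "F \<in> \<F>" "\<rho> F \<subseteq> B"
    and K: "\<And>n. \<exists>K. finite K \<and> K \<subseteq> \<Omega> \<and> \<rho> (F - K) \<inter> - A n = {}"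
    using assms[unfolded diagonal_def, rule_format, of "\<lambda>n. - A n"] by blast
  then show "\<exists>F\<in>\<F>. \<forall>n. rho_almost_subset \<Omega> \<rho> F (A n)"
    unfolding rho_almost_subset_def by (auto simp: disjoint_eq_subset_Compl)
qed

lemma P_from_imp_diagonal:
  assumes P: "P_from B" and B: "B \<subseteq> \<Lambda>" "pos B"
  shows "diagonal B"
  unfolding diagonal_def
proof (intro allI impI)
  fix C :: "nat \<Rightarrow> 'l set"
  assume C: "\<forall>n. \<not> pos (B \<inter> C n)"
  \<comment> \<open>Removing the first \<open>n\<close> sets gives \<open>A 0 = B\<close>, and
    passing from \<open>A n\<close> to \<open>A (Suc n)\<close> loses only points of
    \<open>B \<inter> C n\<close>.\<close>
  define A where "A n = B - (\<Union>i<n. C i)" for n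
  have "pos (A n)" for n
  proof (rule ccontr)
    assume "\<not> pos (A n)"
    moreover have "pos (A n \<union> (\<Union>i<n. B \<inter> C i))"
      using B(2) by (rule pos_mono) (auto simp: A_def)
    ultimately show False
      using C pos_Un pos_finite_UN[of "{..<n}" "\<lambda>i. B \<inter> C i"] by blast
  qed
  moreover have "\<not> pos (A n - A (Suc n))" for n
  proof -
    have "A n - A (Suc n) \<subseteq> B \<inter> C n"
      by (auto simp: A_def less_Suc_eq)
    then show ?thesis
      using C pos_mono by blast
  qed
  moreover have "decseq A"
    by (rule decseq_SucI) (auto simp: A_def less_Suc_eq)
  moreover have "A 0 = B" "\<And>n. A n \<subseteq> \<Lambda>"
    using B by (auto simp: A_def)
  ultimately obtain F where F: "F \<in> \<F>" "\<And>n. rho_almost_subset \<Omega> \<rho> F (A n)"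
    using P unfolding P_from_def rho_positive_iff rho_ideal_iff by (metis Diff_subset subset_trans)
  \<comment> \<open>Only an almost inclusion in \<open>A 0 = B\<close> is known, so
    \<open>F - K\<close> replaces \<open>F\<close>, and each further escape is rechecked for
    it.\<close>
  obtain K where K: "finite K" "K \<subseteq> \<Omega>" "\<rho> (F - K) \<subseteq> B"
    using F(2)[of 0] unfolding A_def rho_almost_subset_def by auto
  have "\<exists>L. finite L \<and> L \<subseteq> \<Omega> \<and> \<rho> (F - K - L) \<inter> C n = {}" for n
  proof -
    obtain L where L: "finite L" "L \<subseteq> \<Omega>" "\<rho> (F - L) \<subseteq> A (Suc n)"
      using F(2)[of "Suc n"] unfolding rho_almost_subset_def by auto
    have "\<rho> (F - (K \<union> L)) \<subseteq> A (Suc n)"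
      using L K rho_Diff_antimono[OF F(1), of "K \<union> L" L] by auto
    then show ?thesis
      using L by (intro exI[of _ L]) (auto simp: A_def Diff_eq Int_assoc)
  qed
  then show "\<exists>F\<in>\<F>. \<rho> F \<subseteq> B \<and> (\<forall>n. \<exists>K. finite K \<and> K \<subseteq> \<Omega> \<and> \<rho> (F - K) \<inter> C n = {})"
    using K family_Diff[OF F(1) K(1,2)] by blast
qed

lemma P_minus_Lambda_iff: "P_minus_Lambda \<Lambda> \<Omega> \<F> \<rho> \<longleftrightarrow> diagonal \<Lambda>"
proof -
  have "P_minus_Lambda \<Lambda> \<Omega> \<F> \<rho> \<longleftrightarrow> P_from \<Lambda>"
    unfolding P_minus_Lambda_def P_from_def ..
  then show ?thesis
    using diagonal_imp_P_from P_from_imp_diagonal pos_Lambda by blast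
qed

lemma P_minus_iff: "P_minus \<Lambda> \<Omega> \<F> \<rho> \<longleftrightarrow> (\<forall>B\<subseteq>\<Lambda>. pos B \<longrightarrow> diagonal B)"
proof -
  have "P_minus \<Lambda> \<Omega> \<F> \<rho> \<longleftrightarrow> (\<forall>B\<subseteq>\<Lambda>. pos B \<longrightarrow> P_from B)"
    unfolding P_minus_def P_from_def rho_positive_iff by blast
  then show ?thesis
    using diagonal_imp_P_from P_from_imp_diagonal by blast
qed

lemma diagonal_countable:
  assumes "diagonal B" "countable \<C>" "\<And>C. C \<in> \<C> \<Longrightarrow> \<not> pos (B \<inter> C)"
  obtains F where "F \<in> \<F>" "\<rho> F \<subseteq> B"
    "\<And>\<D>. finite \<D> \<Longrightarrow> \<D> \<subseteq> \<C> \<Longrightarrow> \<exists>K. finite K \<and> K \<subseteq> \<Omega> \<and> \<rho> (F - K) \<inter> \<Union>\<D> = {}"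
proof -
  \<comment> \<open>The inserted empty set, itself null, makes the family nonempty, so that
    \<open>from_nat_into\<close> runs through exactly this family even when \<open>\<C>\<close> is
    empty or finite.\<close>
  define C where "C = from_nat_into (insert {} \<C>)"
  have C: "range C = insert {} \<C>"
    using assms(2) by (simp add: C_def)
  have "\<not> pos (B \<inter> C n)" for n
  proof -
    have "C n \<in> insert {} \<C>"
      using C by blast
    then show ?thesis
      using assms(3) pos_imp_infinite by fastforce
  qed
  then obtain F where F: "F \<in> \<F>" "\<rho> F \<subseteq> B"
    and esc: "\<And>n. \<exists>K. finite K \<and> K \<subseteq> \<Omega> \<and> \<rho> (F - K) \<inter> C n = {}"
    using assms(1) unfolding diagonal_def by metis
  have "\<exists>K. finite K \<and> K \<subseteq> \<Omega> \<and> \<rho> (F - K) \<inter> \<Union>\<D> = {}" if "finite \<D>" "\<D> \<subseteq> \<C>" for \<D>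
  proof (rule uniform_escape[OF F(1) that(1)])
    fix D assume "D \<in> \<D>"
    then have "D \<in> range C"
      using that(2) unfolding C by blast
    then obtain n where "D = C n"
      by (rule rangeE)
    then show "\<exists>K. finite K \<and> K \<subseteq> \<Omega> \<and> \<rho> (F - K) \<inter> D = {}"
      using esc by blast
  qed
  then show thesis
    using that F by blast
qed

lemma rho_convergent_constant:
  assumes "pos {l \<in> B. f l = x}" "x \<in> topspace X"
  shows "\<exists>F\<in>\<F>. \<rho> F \<subseteq> B \<and> (\<exists>x. rho_convergent_to \<Omega> \<rho> X F f x)"
proof -
  obtain F where "F \<in> \<F>" "\<rho> F \<subseteq> {l \<in> B. f l = x}"
    using assms unfolding pos_def by blast
  then show ?thesis
    unfolding rho_convergent_to_def using assms(2)
    by (intro bexI[of _ F] conjI exI[of _ x] allI impI exI[of _ "{}"]) auto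
qed

section \<open>Finite spaces, sequential compactness and functions that are not tall\<close>

lemma finite_in_FinBW:
  assumes "finite (topspace X)"
  shows "X \<in> FinBW \<Lambda> \<Omega> \<F> \<rho>"
  unfolding FinBW_iff BW_on_def
proof
  fix f assume f: "f \<in> \<Lambda> \<rightarrow> topspace X"
  have "pos (\<Union>x\<in>topspace X. {l \<in> \<Lambda>. f l = x})"
    using pos_Lambda by (rule pos_mono) (use f in auto)
  then obtain x where "x \<in> topspace X" "pos {l \<in> \<Lambda>. f l = x}"
    using pos_finite_UN[OF assms, of "\<lambda>x. {l \<in> \<Lambda>. f l = x}"] by blast
  then show "\<exists>F\<in>\<F>. \<rho> F \<subseteq> \<Lambda> \<and> (\<exists>x. rho_convergent_to \<Omega> \<rho> X F f x)"
    by (intro rho_convergent_constant)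
qed

text \<open>Picking one point from each \<open>\<rho> (F - J n)\<close>, where the finite sets
  \<open>J n\<close> exhaust \<open>\<Omega>\<close>, yields an infinite set almost contained in
  every \<open>\<rho> (F - K)\<close>. It translates \<rho>-convergence into convergence of an
  ordinary sequence.\<close>

lemma rho_pseudointersection:
  assumes "F \<in> \<F>"
  obtains r :: "nat \<Rightarrow> nat" where "strict_mono r"
    "\<And>K. finite K \<Longrightarrow> K \<subseteq> \<Omega> \<Longrightarrow> \<exists>N. \<forall>n\<ge>N. r n \<in> to_nat_on \<Lambda> ` \<rho> (F - K)"
proof -
  define J where "J n = from_nat_into \<Omega> ` {..<n}" for n :: nat
  have J: "finite (J n)" "J n \<subseteq> \<Omega>" for n
    unfolding J_def using from_nat_into[of \<Omega>] infinite_Omega by auto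
  have inj: "inj_on (to_nat_on \<Lambda>) (\<rho> (F - J n))" for n
    using countable_Lambda rho_subset[OF family_Diff[OF assms J]]
    by (meson inj_on_subset inj_on_to_nat_on)
  obtain r where r: "strict_mono r" "\<And>n. r n \<in> to_nat_on \<Lambda> ` \<rho> (F - J n)"
    using infinite_sets_strict_mono_choice[of "\<lambda>n. to_nat_on \<Lambda> ` \<rho> (F - J n)"]
      finite_imageD[OF _ inj] infinite_rho[OF family_Diff[OF assms J]] by metis
  have "\<exists>N. \<forall>n\<ge>N. r n \<in> to_nat_on \<Lambda> ` \<rho> (F - K)" if K: "finite K" "K \<subseteq> \<Omega>" for K
  proof -
    \<comment> \<open>The bound exceeds all indices of points of \<open>K\<close>; the inserted 0
      keeps \<open>Max\<close> meaningful for empty \<open>K\<close>.\<close>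
    have "K \<subseteq> J n" if "n > Max (insert 0 (to_nat_on \<Omega> ` K))" for n
    proof
      fix w assume w: "w \<in> K"
      have "to_nat_on \<Omega> w < n"
        using that w K(1) by (auto intro: order_le_less_trans[rotated])
      moreover have "from_nat_into \<Omega> (to_nat_on \<Omega> w) = w"
        using w K(2) countable_Omega by auto
      ultimately show "w \<in> J n"
        unfolding J_def by (metis imageI lessThan_iff)
    qed
    then have "\<rho> (F - J n) \<subseteq> \<rho> (F - K)" if "n > Max (insert 0 (to_nat_on \<Omega> ` K))" for n
      using that rho_Diff_antimono[OF assms J] by blast
    then show ?thesis
      using r(2) by (meson Suc_le_eq image_mono subsetD)
  qed
  then show thesis
    using that r(1) by blast
qed

lemma FinBW_imp_sequentially_compact:
  assumes "X \<in> FinBW \<Lambda> \<Omega> \<F> \<rho>"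
  shows "sequentially_compact_space X"
  unfolding sequentially_compact_space_def
proof (intro allI impI)
  fix s :: "nat \<Rightarrow> 'a" assume s: "range s \<subseteq> topspace X"
  then have "s \<circ> to_nat_on \<Lambda> \<in> \<Lambda> \<rightarrow> topspace X"
    by auto
  then obtain F x where F: "F \<in> \<F>" and x: "rho_convergent_to \<Omega> \<rho> X F (s \<circ> to_nat_on \<Lambda>) x"
    using assms unfolding FinBW_def by blast
  obtain r :: "nat \<Rightarrow> nat" where r: "strict_mono r"
    "\<And>K. finite K \<Longrightarrow> K \<subseteq> \<Omega> \<Longrightarrow> \<exists>N. \<forall>n\<ge>N. r n \<in> to_nat_on \<Lambda> ` \<rho> (F - K)"
    using rho_pseudointersection[OF F] by blast
  have "limitin X (s \<circ> r) x sequentially"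
    unfolding limitin_def
  proof (intro conjI allI impI)
    show "x \<in> topspace X"
      using x unfolding rho_convergent_to_def by blast
    fix U assume "openin X U \<and> x \<in> U"
    then obtain K where K: "finite K" "K \<subseteq> \<Omega>" "(s \<circ> to_nat_on \<Lambda>) ` \<rho> (F - K) \<subseteq> U"
      using x unfolding rho_convergent_to_def by blast
    obtain N where "\<And>n. n \<ge> N \<Longrightarrow> r n \<in> to_nat_on \<Lambda> ` \<rho> (F - K)"
      using r(2)[OF K(1,2)] by blast
    then have "(s \<circ> r) n \<in> U" if "n \<ge> N" for n
      using K(3) that by fastforce
    then show "\<forall>\<^sub>F n in sequentially. (s \<circ> r) n \<in> U"
      unfolding eventually_sequentially by blast
  qed
  then show "\<exists>r l. strict_mono r \<and> limitin X (s \<circ> r) l sequentially"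
    using r(1) by blast
qed

text \<open>Every infinite subset of a witness \<open>A\<close> against tallness is positive, so
  some \<open>\<rho> F\<close> lies inside the range of a convergent subsequence. By condition (S),
  a smaller \<open>E\<close> leaves the finitely many exceptional terms of each
  neighbourhood.\<close>

lemma not_tall_imp_FinBW:
  assumes nt: "\<not> tall \<Lambda> \<F> \<rho>" and X: "sequentially_compact_space X"
  shows "X \<in> FinBW \<Lambda> \<Omega> \<F> \<rho>"
  unfolding FinBW_iff BW_on_def
proof
  fix f assume f: "f \<in> \<Lambda> \<rightarrow> topspace X"
  obtain A where A: "A \<subseteq> \<Lambda>" "infinite A" and Apos: "\<And>B. B \<subseteq> A \<Longrightarrow> infinite B \<Longrightarrow> pos B"
    using nt unfolding tall_def rho_ideal_iff by (meson subset_trans)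
  define e where "e = from_nat_into A"
  have "countable A"
    using A countable_Lambda countable_subset by blast
  then have e: "bij_betw e UNIV A"
    unfolding e_def using A(2) by (rule bij_betw_from_nat_into)
  then have "range (f \<circ> e) \<subseteq> topspace X"
    using f A(1) by (auto simp: bij_betw_def)
  then obtain r l where r: "strict_mono r" and lim: "limitin X (f \<circ> e \<circ> r) l sequentially"
    using X unfolding sequentially_compact_space_def by blast
  have inj: "inj (e \<circ> r)"
    using e r by (intro inj_compose) (auto simp: bij_betw_def strict_mono_imp_inj_on)
  have sub: "range (e \<circ> r) \<subseteq> A"
    using e by (auto simp: bij_betw_def)
  have "pos (range (e \<circ> r))"
    using sub inj by (intro Apos) (auto dest: range_inj_infinite)
  then obtain F where F: "F \<in> \<F>" "\<rho> F \<subseteq> range (e \<circ> r)"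
    unfolding pos_def by blast
  obtain E where E: "E \<in> \<F>" "E \<subseteq> F"
    and esc: "\<And>C. finite C \<Longrightarrow> \<exists>K. finite K \<and> K \<subseteq> \<Omega> \<and> \<rho> (E - K) \<inter> C = {}"
    using sparse_escape[OF F(1)] by blast
  have "rho_convergent_to \<Omega> \<rho> X E f l"
    unfolding rho_convergent_to_def
  proof (intro conjI allI impI)
    show "l \<in> topspace X"
      using lim unfolding limitin_def by blast
    fix U assume "openin X U \<and> l \<in> U"
    then have "finite {n. (f \<circ> e \<circ> r) n \<notin> U}"
      using finite_exceptions_limitin[OF lim] by blast
    then obtain K where K: "finite K" "K \<subseteq> \<Omega>"
      "\<rho> (E - K) \<inter> (e \<circ> r) ` {n. (f \<circ> e \<circ> r) n \<notin> U} = {}"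
      using esc[of "(e \<circ> r) ` {n. (f \<circ> e \<circ> r) n \<notin> U}"] by blast
    have "\<rho> (E - K) \<subseteq> range (e \<circ> r)"
      using rho_Diff_subset[OF E(1) K(1,2)] rho_mono[OF E(1) F(1) E(2)] F(2) by blast
    then have "f ` \<rho> (E - K) \<subseteq> U"
      using K(3) by fastforce
    then show "\<exists>K. finite K \<and> K \<subseteq> \<Omega> \<and> f ` \<rho> (E - K) \<subseteq> U"
      using K by blast
  qed
  then show "\<exists>F\<in>\<F>. \<rho> F \<subseteq> \<Lambda> \<and> (\<exists>x. rho_convergent_to \<Omega> \<rho> X F f x)"
    using E(1) rho_subset by blast
qed

end

section \<open>Compact Hausdorff spaces and the P-properties\<close>

text \<open>For \<open>a \<in> A\<close>, the one-point compactification of the discrete set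
  \<open>A - {a}\<close>. Its points are those of \<open>A\<close>, so every cardinality that a
  subset of the type has is realised without leaving the type.\<close>

definition one_point_space :: "'a set \<Rightarrow> 'a \<Rightarrow> 'a topology" where
  "one_point_space A a = topology (\<lambda>U. U \<subseteq> A \<and> (a \<in> U \<longrightarrow> finite (A - U)))"

lemma openin_one_point_space:
  "openin (one_point_space A a) U \<longleftrightarrow> U \<subseteq> A \<and> (a \<in> U \<longrightarrow> finite (A - U))"
proof -
  have "istopology (\<lambda>U. U \<subseteq> A \<and> (a \<in> U \<longrightarrow> finite (A - U)))"
    unfolding istopology_def
  proof (intro conjI allI impI)
    fix \<K> assume K: "\<forall>K\<in>\<K>. K \<subseteq> A \<and> (a \<in> K \<longrightarrow> finite (A - K))"
    then show "\<Union>\<K> \<subseteq> A"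
      by blast
    assume "a \<in> \<Union>\<K>"
    then obtain K where "K \<in> \<K>" "finite (A - K)"
      using K by blast
    then show "finite (A - \<Union>\<K>)"
      by (meson Diff_mono Union_upper finite_subset order_refl)
  qed (auto simp: Diff_Int)
  then show ?thesis
    unfolding one_point_space_def by (simp add: topology_inverse')
qed

lemma topspace_one_point_space: "topspace (one_point_space A a) = A"
proof
  show "A \<subseteq> topspace (one_point_space A a)"
    by (rule openin_subset) (auto simp: openin_one_point_space)
  show "topspace (one_point_space A a) \<subseteq> A"
    using openin_topspace[of "one_point_space A a"] unfolding openin_one_point_space by blast
qed

lemma Hausdorff_one_point_space: "Hausdorff_space (one_point_space A a)"
  unfolding Hausdorff_space_def
proof (intro allI impI)
  fix x y
  assume "x \<in> topspace (one_point_space A a) \<and> y \<in> topspace (one_point_space A a) \<and> x \<noteq> y"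
  then have xy: "x \<in> A" "y \<in> A" "x \<noteq> y"
    by (auto simp: topspace_one_point_space)
  show "\<exists>U V. openin (one_point_space A a) U \<and> openin (one_point_space A a) V \<and>
    x \<in> U \<and> y \<in> V \<and> disjnt U V"
  proof (cases "x = a")
    case True
    then show ?thesis
      using xy by (intro exI[of _ "A - {y}"] exI[of _ "{y}"])
        (auto simp: openin_one_point_space disjnt_def Diff_Diff_Int)
  next
    case False
    then show ?thesis
      using xy by (intro exI[of _ "{x}"] exI[of _ "A - {x}"])
        (auto simp: openin_one_point_space disjnt_def Diff_Diff_Int)
  qed
qed

text \<open>The conditional hypothesis keeps the empty space in scope, since the statement ranges
  over all \<open>A\<close>.\<close>

lemma compact_one_point_space:
  assumes "A \<noteq> {} \<Longrightarrow> a \<in> A"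
  shows "compact_space (one_point_space A a)"
  unfolding compact_space_alt topspace_one_point_space
proof (intro allI impI)
  fix \<U> assume "(\<forall>U\<in>\<U>. openin (one_point_space A a) U) \<and> A \<subseteq> \<Union>\<U>"
  then have U: "\<forall>U\<in>\<U>. openin (one_point_space A a) U" "A \<subseteq> \<Union>\<U>"
    by auto
  show "\<exists>\<F>. finite \<F> \<and> \<F> \<subseteq> \<U> \<and> A \<subseteq> \<Union>\<F>"
  proof (cases "A = {}")
    case False
    then obtain V where V: "V \<in> \<U>" "a \<in> V" "finite (A - V)"
      using assms U unfolding openin_one_point_space by blast
    have "\<forall>x\<in>A - V. \<exists>W. W \<in> \<U> \<and> x \<in> W"
      using U(2) by blast
    then obtain g where g: "\<And>x. x \<in> A - V \<Longrightarrow> g x \<in> \<U> \<and> x \<in> g x"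
      by metis
    show ?thesis
      using V g by (intro exI[of _ "insert V (g ` (A - V))"]) auto
  qed auto
qed

context partition_regular_function
begin

lemma diagonal_imp_BW_one_point_space:
  assumes B: "diagonal B" "B \<subseteq> \<Lambda>" "pos B" and a: "A \<noteq> {} \<Longrightarrow> a \<in> A"
  shows "BW_on B (one_point_space A a)"
  unfolding BW_on_def topspace_one_point_space
proof
  fix f assume f: "f \<in> B \<rightarrow> A"
  show "\<exists>F\<in>\<F>. \<rho> F \<subseteq> B \<and> (\<exists>x. rho_convergent_to \<Omega> \<rho> (one_point_space A a) F f x)"
  proof (cases "\<exists>x\<in>A. pos {l \<in> B. f l = x}")
    case True
    then show ?thesis
      using rho_convergent_constant topspace_one_point_space by metis
  next
    case False
    have "B \<noteq> {}"
      using pos_imp_infinite[OF B(3)] by auto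
    then have "a \<in> A"
      using a f by blast
    \<comment> \<open>The fibres are indexed by the values of \<open>f\<close> on the countable set
      \<open>B\<close>, so they are countably many even for uncountable \<open>A\<close>.\<close>
    define \<C> where "\<C> = (\<lambda>x. {l \<in> B. f l = x}) ` f ` B"
    have "countable \<C>"
      unfolding \<C>_def using B(2) countable_Lambda by (intro countable_image) (rule countable_subset)
    moreover have "\<not> pos (B \<inter> C)" if "C \<in> \<C>" for C
      using that False f pos_mono[of "B \<inter> C" C] unfolding \<C>_def by blast
    ultimately obtain F where F: "F \<in> \<F>" "\<rho> F \<subseteq> B"
      and esc: "\<And>\<D>. finite \<D> \<Longrightarrow> \<D> \<subseteq> \<C> \<Longrightarrow>
        \<exists>K. finite K \<and> K \<subseteq> \<Omega> \<and> \<rho> (F - K) \<inter> \<Union>\<D> = {}"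
      using diagonal_countable[OF B(1)] by metis
    have "rho_convergent_to \<Omega> \<rho> (one_point_space A a) F f a"
      unfolding rho_convergent_to_def topspace_one_point_space openin_one_point_space
    proof (intro conjI allI impI)
      fix U assume U: "(U \<subseteq> A \<and> (a \<in> U \<longrightarrow> finite (A - U))) \<and> a \<in> U"
      define \<D> where "\<D> = (\<lambda>x. {l \<in> B. f l = x}) ` ((A - U) \<inter> f ` B)"
      have "finite \<D>" "\<D> \<subseteq> \<C>"
        using U unfolding \<D>_def \<C>_def by auto
      then obtain K where K: "finite K" "K \<subseteq> \<Omega>" "\<rho> (F - K) \<inter> \<Union>\<D> = {}"
        using esc[of \<D>] by metis
      have "f ` \<rho> (F - K) \<subseteq> U"
      proof (rule image_subsetI, rule ccontr)
        fix l assume l: "l \<in> \<rho> (F - K)" "f l \<notin> U"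
        then have "l \<in> B"
          using rho_Diff_subset[OF F(1) K(1,2)] F(2) by blast
        then have "l \<in> \<Union>\<D>"
          using l(2) f unfolding \<D>_def by blast
        then show False
          using K(3) l(1) by blast
      qed
      then show "\<exists>K. finite K \<and> K \<subseteq> \<Omega> \<and> f ` \<rho> (F - K) \<subseteq> U"
        using K by blast
    qed fact
    then show ?thesis
      using F by blast
  qed
qed

end

section \<open>Infinite Hausdorff members force the P-properties\<close>

lemma infinite_sequentially_compact_limit:
  fixes X :: "'a topology"
  assumes "sequentially_compact_space X" "infinite (topspace X)"
  obtains s x where "inj s" "range s \<subseteq> topspace X" "limitin X s x sequentially" "x \<notin> range s"
proof -
  obtain s0 :: "nat \<Rightarrow> 'a" where s0: "inj s0" "range s0 \<subseteq> topspace X"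
    using assms(2) infinite_countable_subset by blast
  obtain r x where r: "strict_mono r" "limitin X (s0 \<circ> r) x sequentially"
    using assms(1) s0(2) unfolding sequentially_compact_space_def by blast
  have inj: "inj (s0 \<circ> r)"
    using s0(1) r(1) by (intro inj_compose) (auto simp: strict_mono_imp_inj_on)
  \<comment> \<open>An injective sequence takes the value \<open>x\<close> at most once, so a tail
    of it misses \<open>x\<close>.\<close>
  obtain N where N: "\<And>n. n \<ge> N \<Longrightarrow> (s0 \<circ> r) n \<noteq> x"
  proof (cases "x \<in> range (s0 \<circ> r)")
    case True
    then obtain m where m: "x = (s0 \<circ> r) m"
      by blast
    have "(s0 \<circ> r) n \<noteq> x" if "n \<ge> Suc m" for n
      using injD[OF inj, of n m] that m by auto
    then show thesis
      using that by blast
  qed (use that in blast)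
  define s where "s = s0 \<circ> r \<circ> (\<lambda>n. n + N)"
  have sm: "strict_mono (\<lambda>n. n + N)"
    by (simp add: strict_mono_def)
  have "inj s"
    unfolding s_def using inj by (rule inj_compose) simp
  moreover have "range s \<subseteq> topspace X"
    using s0(2) by (auto simp: s_def)
  moreover have "limitin X s x sequentially"
    unfolding s_def by (rule limitin_subsequence[OF sm r(2)])
  moreover have "x \<notin> range s"
    using N by (auto simp: s_def) (metis le_add2)
  ultimately show thesis
    using that by blast
qed

context partition_regular_function
begin

text \<open>The test map sends a point to the term of \<open>s\<close> indexed by the first
  \<open>C n\<close> containing it, and to the limit \<open>x\<close> if there is none; converging
  to \<open>x\<close> then means escaping every \<open>C n\<close>. Allowing a smaller
  \<open>B'\<close> lets a hypothesis about \<open>\<rho> E\<close> serve any positive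
  \<open>B\<close> above it.\<close>

lemma BW_infinite_Hausdorff_imp_diagonal:
  fixes X :: "'a topology"
  assumes X: "infinite (topspace X)" "Hausdorff_space X" "sequentially_compact_space X"
    and BW: "BW_on B' X" and sub: "B' \<subseteq> B"
  shows "diagonal B"
  unfolding diagonal_def
proof (intro allI impI)
  fix C :: "nat \<Rightarrow> 'l set"
  assume C: "\<forall>n. \<not> pos (B \<inter> C n)"
  obtain s x where s: "inj s" "range s \<subseteq> topspace X" "limitin X s x sequentially" "x \<notin> range s"
    using infinite_sequentially_compact_limit[OF X(3,1)] by blast
  have xX: "x \<in> topspace X"
    using s(3) unfolding limitin_def by blast
  define g where "g l = (LEAST n. l \<in> C n)" for l
  define f where "f l = (if \<exists>n. l \<in> C n then s (g l) else x)" for l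
  have g: "l \<in> C (g l)" if "l \<in> C n" for l n
    using LeastI[of "\<lambda>n. l \<in> C n"] that unfolding g_def by blast
  have "f \<in> B' \<rightarrow> topspace X"
    using s(2) xX unfolding f_def by (auto simp: image_subset_iff)
  then obtain F y where F: "F \<in> \<F>" "\<rho> F \<subseteq> B'" and y: "rho_convergent_to \<Omega> \<rho> X F f y"
    using BW unfolding BW_on_def by blast
  have yX: "y \<in> topspace X"
    and conv: "\<And>U. openin X U \<Longrightarrow> y \<in> U \<Longrightarrow> \<exists>K. finite K \<and> K \<subseteq> \<Omega> \<and> f ` \<rho> (F - K) \<subseteq> U"
    using y unfolding rho_convergent_to_def by auto
  \<comment> \<open>Near any other limit only finitely many terms of \<open>s\<close> occur as
    values and \<open>x\<close> does not, so some \<open>\<rho> (F - K)\<close> would be covered by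
    finitely many null sets.\<close>
  have "y = x"
  proof (rule ccontr)
    assume "y \<noteq> x"
    then obtain U V where UV: "openin X U" "openin X V" "y \<in> U" "x \<in> V" "disjnt U V"
      using X(2) yX xX unfolding Hausdorff_space_def by metis
    define M where "M = {n. s n \<notin> V}"
    have "finite M"
      unfolding M_def using finite_exceptions_limitin[OF s(3) UV(2,4)] .
    obtain K where K: "finite K" "K \<subseteq> \<Omega>" "f ` \<rho> (F - K) \<subseteq> U"
      using conv[OF UV(1,3)] by blast
    have "\<rho> (F - K) \<subseteq> (\<Union>n\<in>M. B \<inter> C n)"
    proof
      fix l assume l: "l \<in> \<rho> (F - K)"
      then have "f l \<notin> V"
        using K(3) UV(5) unfolding disjnt_def by blast
      then have "\<exists>n. l \<in> C n" "s (g l) \<notin> V"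
        using UV(4) unfolding f_def by (auto split: if_splits)
      then have "g l \<in> M" "l \<in> C (g l)"
        using g unfolding M_def by blast+
      moreover have "l \<in> B"
        using l rho_Diff_subset[OF F(1) K(1,2)] F(2) sub by blast
      ultimately show "l \<in> (\<Union>n\<in>M. B \<inter> C n)"
        by blast
    qed
    then have "pos (\<Union>n\<in>M. B \<inter> C n)"
      using pos_mono[OF pos_rho[OF family_Diff[OF F(1) K(1,2)]]] by blast
    then show False
      using pos_finite_UN[OF \<open>finite M\<close>, of "\<lambda>n. B \<inter> C n"] C by blast
  qed
  have "\<exists>K. finite K \<and> K \<subseteq> \<Omega> \<and> \<rho> (F - K) \<inter> C n = {}" for n
  proof -
    \<comment> \<open>All terms up to \<open>n\<close> are removed, because a point of
      \<open>C n\<close> is sent to the term of its least index, which may be smaller than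
      \<open>n\<close>.\<close>
    have "closedin X (s ` {..n})"
      using Hausdorff_imp_t1_space[OF X(2)] s(2) by (auto simp: t1_space_closedin_finite)
    then have "openin X (topspace X - s ` {..n})"
      by blast
    moreover have "y \<in> topspace X - s ` {..n}"
      using xX s(4) \<open>y = x\<close> by blast
    ultimately obtain K where K: "finite K" "K \<subseteq> \<Omega>" "f ` \<rho> (F - K) \<subseteq> topspace X - s ` {..n}"
      using conv by metis
    have "f l \<in> s ` {..n}" if "l \<in> C n" for l
    proof -
      have "g l \<le> n"
        unfolding g_def using that by (rule Least_le)
      then show ?thesis
        using that unfolding f_def by auto
    qed
    then have "\<rho> (F - K) \<inter> C n = {}"
      using K(3) by blast
    then show ?thesis
      using K by blast
  qed
  then show "\<exists>F\<in>\<F>. \<rho> F \<subseteq> B \<and> (\<forall>n. \<exists>K. finite K \<and> K \<subseteq> \<Omega> \<and> \<rho> (F - K) \<inter> C n = {})"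
    using F sub by blast
qed

lemma P_minus_Lambda_imp_compact_Hausdorff:
  fixes A :: "'a set"
  assumes "P_minus_Lambda \<Lambda> \<Omega> \<F> \<rho>"
  shows "\<exists>X :: 'a topology. topspace X \<approx> A \<and> Hausdorff_space X \<and> compact_space X \<and>
    X \<in> FinBW \<Lambda> \<Omega> \<F> \<rho>"
proof -
  obtain a where a: "A \<noteq> {} \<Longrightarrow> a \<in> A"
    by blast
  have "one_point_space A a \<in> FinBW \<Lambda> \<Omega> \<F> \<rho>"
    using assms a pos_Lambda unfolding FinBW_iff P_minus_Lambda_iff
    by (intro diagonal_imp_BW_one_point_space) auto
  then show ?thesis
    using Hausdorff_one_point_space compact_one_point_space[OF a] topspace_one_point_space[of A a]
    by (intro exI[of _ "one_point_space A a"]) auto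
qed

lemma P_minus_imp_compact_Hausdorff:
  fixes A :: "'a set"
  assumes "P_minus \<Lambda> \<Omega> \<F> \<rho>"
  shows "\<exists>X :: 'a topology. topspace X \<approx> A \<and> Hausdorff_space X \<and> compact_space X \<and>
    X \<in> hFinBW \<Omega> \<F> \<rho>"
proof -
  obtain a where a: "A \<noteq> {} \<Longrightarrow> a \<in> A"
    by blast
  have "one_point_space A a \<in> hFinBW \<Omega> \<F> \<rho>"
    unfolding hFinBW_iff
    using assms a pos_rho rho_subset unfolding P_minus_iff
    by (intro ballI diagonal_imp_BW_one_point_space) auto
  then show ?thesis
    using Hausdorff_one_point_space compact_one_point_space[OF a] topspace_one_point_space[of A a]
    by (intro exI[of _ "one_point_space A a"]) auto
qed

lemma infinite_Hausdorff_FinBW_imp_P_minus_Lambda: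
  fixes X :: "'a topology"
  assumes "infinite (topspace X)" "Hausdorff_space X" "X \<in> FinBW \<Lambda> \<Omega> \<F> \<rho>"
  shows "P_minus_Lambda \<Lambda> \<Omega> \<F> \<rho>"
  unfolding P_minus_Lambda_iff
  using assms FinBW_imp_sequentially_compact[OF assms(3)]
  by (intro BW_infinite_Hausdorff_imp_diagonal[of X \<Lambda> \<Lambda>]) (auto simp: FinBW_iff)

lemma infinite_Hausdorff_hFinBW_imp_P_minus:
  fixes X :: "'a topology"
  assumes "infinite (topspace X)" "Hausdorff_space X" "X \<in> hFinBW \<Omega> \<F> \<rho>"
  shows "P_minus \<Lambda> \<Omega> \<F> \<rho>"
  unfolding P_minus_iff
proof (intro allI impI)
  fix B assume "B \<subseteq> \<Lambda>" "pos B"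
  then obtain E where E: "E \<in> \<F>" "\<rho> E \<subseteq> B"
    unfolding pos_def by blast
  have "BW_on (\<rho> E) X"
    using assms(3) E(1) unfolding hFinBW_iff by blast
  moreover have "sequentially_compact_space X"
    using assms(3) by (intro FinBW_imp_sequentially_compact hFinBW_subset_FinBW)
  ultimately show "diagonal B"
    using BW_infinite_Hausdorff_imp_diagonal assms(1,2) E(2) by blast
qed

section \<open>Positive preimages of neighbourhoods and the properties P-plus and weak
  P-plus\<close>

lemma rho_cluster_point:
  assumes C: "compactin X C" and f: "f \<in> B \<rightarrow> C" and B: "pos B"
  shows "\<exists>x\<in>C. \<forall>U. openin X U \<and> x \<in> U \<longrightarrow> pos {l \<in> B. f l \<in> U}"
proof (rule ccontr)
  assume "\<not> ?thesis"
  then obtain U where U: "\<And>x. x \<in> C \<Longrightarrow> openin X (U x) \<and> x \<in> U x \<and> \<not> pos {l \<in> B. f l \<in> U x}"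
    by metis
  have "(\<forall>V\<in>U ` C. openin X V) \<and> C \<subseteq> \<Union>(U ` C)"
    using U by blast
  then obtain \<V> where V: "finite \<V>" "\<V> \<subseteq> U ` C" "C \<subseteq> \<Union>\<V>"
    using C unfolding compactin_def by meson
  \<comment> \<open>A finite subcover cuts the positive set \<open>B\<close> into finitely many
    pieces; one of them is positive, against the choice of \<open>U\<close>.\<close>
  have "pos (\<Union>V\<in>\<V>. {l \<in> B. f l \<in> V})"
    using B by (rule pos_mono) (use f V(3) in blast)
  then obtain V where "V \<in> \<V>" "pos {l \<in> B. f l \<in> V}"
    using pos_finite_UN[OF V(1), of "\<lambda>V. {l \<in> B. f l \<in> V}"] by blast
  then show False
    using V(2) U by blast
qed

text \<open>The closure of the countable image is compact, so it has a point all of whose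
  neighbourhoods have positive preimage. First countability there leaves only a decreasing sequence
  of preimages, to which \<open>P_plus\<close> applies.\<close>

lemma P_plus_property_star:
  assumes P: "P_plus \<Lambda> \<Omega> \<F> \<rho>" and X: "property_star X"
  shows "X \<in> hFinBW \<Omega> \<F> \<rho>"
  unfolding hFinBW_iff BW_on_def
proof (intro ballI)
  fix E f assume E: "E \<in> \<F>" and f: "f \<in> \<rho> E \<rightarrow> topspace X"
  let ?C = "X closure_of (f ` \<rho> E)"
  have "countable (f ` \<rho> E)"
    using countable_Lambda rho_subset[OF E] by (meson countable_image countable_subset)
  then have C: "compactin X ?C" "first_countable (subtopology X ?C)"
    using X f unfolding property_star_def by blast+
  have fC: "f ` \<rho> E \<subseteq> ?C"
    using f by (intro closure_of_subset) auto
  then obtain x where x: "x \<in> ?C" and pos: "\<And>U. openin X U \<Longrightarrow> x \<in> U \<Longrightarrow> pos {l \<in> \<rho> E. f l \<in> U}"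
    using rho_cluster_point[OF C(1) _ pos_rho[OF E], of f] by blast
  have xX: "x \<in> topspace X"
    using x closure_of_subset_topspace[of X] by blast
  then have "x \<in> topspace (subtopology X ?C)"
    using x by simp
  then obtain \<B> where B: "countable \<B>" "\<And>V. V \<in> \<B> \<Longrightarrow> openin (subtopology X ?C) V"
    "\<And>U. openin (subtopology X ?C) U \<Longrightarrow> x \<in> U \<Longrightarrow> \<exists>V\<in>\<B>. x \<in> V \<and> V \<subseteq> U"
    using C(2) unfolding first_countable_def by meson
  \<comment> \<open>Adding the whole closure makes the local base nonempty, hence enumerable by
    \<open>from_nat_into\<close>.\<close>
  define \<B>' where "\<B>' = insert ?C {V \<in> \<B>. x \<in> V}"
  have cB: "countable \<B>'"
    using B(1) unfolding \<B>'_def by simp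
  define V where "V = from_nat_into \<B>'"
  have rV: "range V = \<B>'"
    unfolding V_def using cB by (simp add: \<B>'_def)
  have Vopen: "\<exists>T. openin X T \<and> x \<in> T \<and> T \<inter> ?C \<subseteq> V n" for n
  proof -
    have "V n \<in> \<B>'"
      using rV by blast
    then consider "V n = ?C" | "V n \<in> \<B>" "x \<in> V n"
      unfolding \<B>'_def by blast
    then show ?thesis
    proof cases
      case 1
      then show ?thesis
        using xX by (intro exI[of _ "topspace X"]) auto
    next
      case 2
      then obtain T where "openin X T" "V n = T \<inter> ?C"
        using B(2) unfolding openin_subtopology by blast
      then show ?thesis
        using 2(2) by blast
    qed
  qed
  then obtain T where T: "\<And>n. openin X (T n)" "\<And>n. x \<in> T n" "\<And>n. T n \<inter> ?C \<subseteq> V n"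
    by metis
  \<comment> \<open>Intersecting the first neighbourhoods makes the preimages decrease; a finite
    intersection is still a neighbourhood of \<open>x\<close>, so they stay positive.\<close>
  define A where "A n = {l \<in> \<rho> E. f l \<in> (\<Inter>i\<le>n. T i)}" for n
  have "A n \<in> rho_positive \<Lambda> \<F> \<rho>" for n
  proof -
    have "pos (A n)"
      unfolding A_def using T(1,2) by (intro pos openin_Inter) auto
    then show ?thesis
      using rho_subset[OF E] unfolding rho_positive_iff A_def by blast
  qed
  moreover have "decseq A"
    unfolding A_def by (rule decseq_SucI) auto
  ultimately obtain F where F: "F \<in> \<F>" "\<And>n. rho_almost_subset \<Omega> \<rho> F (A n)"
    using P unfolding P_plus_def by blast
  obtain K where K: "finite K" "K \<subseteq> \<Omega>" "\<rho> (F - K) \<subseteq> A 0"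
    using F(2)[of 0] unfolding rho_almost_subset_def by blast
  have FK: "F - K \<in> \<F>"
    using family_Diff F(1) K by blast
  have "rho_convergent_to \<Omega> \<rho> X (F - K) f x"
    unfolding rho_convergent_to_def
  proof (intro conjI allI impI)
    fix U assume U: "openin X U \<and> x \<in> U"
    then have "openin (subtopology X ?C) (U \<inter> ?C)" "x \<in> U \<inter> ?C"
      using x by (auto intro: openin_subtopology_Int)
    then obtain W where W: "W \<in> \<B>" "x \<in> W" "W \<subseteq> U \<inter> ?C"
      using B(3) by meson
    then have "W \<in> range V"
      unfolding rV \<B>'_def by blast
    then obtain n where n: "W = V n"
      by blast
    obtain L where L: "finite L" "L \<subseteq> \<Omega>" "\<rho> (F - L) \<subseteq> A n"
      using F(2)[of n] unfolding rho_almost_subset_def by blast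
    have "\<rho> (F - (K \<union> L)) \<subseteq> A n"
      using rho_Diff_antimono[OF F(1), of "K \<union> L" L] K L by auto
    moreover have "f ` A n \<subseteq> U"
      using T(3)[of n] W(3) fC unfolding A_def n by blast
    ultimately have "f ` \<rho> (F - K - L) \<subseteq> U"
      by (metis Diff_Un Diff_Diff_Int Diff_eq Int_assoc Un_commute image_mono subset_trans Compl_Un)
    then show "\<exists>L. finite L \<and> L \<subseteq> \<Omega> \<and> f ` \<rho> (F - K - L) \<subseteq> U"
      using L by blast
  qed fact
  moreover have "\<rho> (F - K) \<subseteq> \<rho> E"
    using K(3) unfolding A_def by blast
  ultimately show "\<exists>F\<in>\<F>. \<rho> F \<subseteq> \<rho> E \<and> (\<exists>x. rho_convergent_to \<Omega> \<rho> X F f x)"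
    using FK by blast
qed

text \<open>Total boundedness lets one shrink the image step by step into closed balls of radius
  \<open>1/(n+1)\<close>. Each step must end in a set \<open>\<rho> (S n)\<close>, not merely a
  positive set, because weak P-plus speaks only about such sequences below
  \<open>F0\<close>.\<close>

lemma weak_P_plus_compact_metric:
  fixes m :: "'a metric"
  assumes P: "weak_P_plus \<Omega> \<F> \<rho>" and comp: "compact_space (mtopology_of m)"
  shows "mtopology_of m \<in> hFinBW \<Omega> \<F> \<rho>"
proof -
  interpret Metric_space "mspace m" "mdist m"
    by (rule Metric_space_mspace_mdist)
  have top: "mtopology_of m = mtopology"
    by (simp add: mtopology_of_def)
  have tb: "mtotally_bounded (mspace m)"
    using comp unfolding top compact_space_def by (simp add: compactin_imp_mtotally_bounded)
  show ?thesis
    unfolding hFinBW_iff BW_on_def top topspace_mtopology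
  proof (intro ballI)
    fix E f assume E: "E \<in> \<F>" and f: "f \<in> \<rho> E \<rightarrow> mspace m"
    obtain F0 where F0: "F0 \<in> \<F>" "\<rho> F0 \<subseteq> \<rho> E"
      and wp: "\<And>S :: nat \<Rightarrow> 'o set. (\<And>n. S n \<in> \<F> \<and> \<rho> (S n) \<subseteq> \<rho> F0 \<and> \<rho> (S (Suc n)) \<subseteq> \<rho> (S n))
        \<Longrightarrow> \<exists>G\<in>\<F>. \<forall>n. rho_almost_subset \<Omega> \<rho> G (\<rho> (S n))"
      using P E unfolding weak_P_plus_def by metis
    have step: "\<exists>H x. H \<in> \<F> \<and> \<rho> H \<subseteq> \<rho> F \<and> f ` \<rho> H \<subseteq> mcball x e"
      if F: "F \<in> \<F>" "\<rho> F \<subseteq> \<rho> F0" and "e > 0" for F e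
    proof -
      obtain D where D: "finite D" "D \<subseteq> mspace m" "mspace m \<subseteq> (\<Union>x\<in>D. mball x e)"
        using tb \<open>e > 0\<close> unfolding mtotally_bounded_def by metis
      have "f ` \<rho> F \<subseteq> mspace m"
        using F(2) F0(2) f by auto
      then have "f ` \<rho> F \<subseteq> (\<Union>x\<in>D. mcball x e)"
        using D(3) mball_subset_mcball by fastforce
      then have "\<rho> F \<subseteq> (\<Union>x\<in>D. {l \<in> \<rho> F. f l \<in> mcball x e})"
        by blast
      then have "pos (\<Union>x\<in>D. {l \<in> \<rho> F. f l \<in> mcball x e})"
        by (rule pos_mono[OF pos_rho[OF F(1)]])
      then obtain x where "pos {l \<in> \<rho> F. f l \<in> mcball x e}"
        using pos_finite_UN[OF D(1), of "\<lambda>x. {l \<in> \<rho> F. f l \<in> mcball x e}"] by blast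
      then obtain H where "H \<in> \<F>" and H: "\<rho> H \<subseteq> {l \<in> \<rho> F. f l \<in> mcball x e}"
        unfolding pos_def by blast
      moreover have "\<rho> H \<subseteq> \<rho> F" "f ` \<rho> H \<subseteq> mcball x e"
        using H by blast+
      ultimately show ?thesis
        by blast
    qed
    define good where "good n p \<longleftrightarrow> fst p \<in> \<F> \<and> \<rho> (fst p) \<subseteq> \<rho> F0 \<and>
      f ` \<rho> (fst p) \<subseteq> mcball (snd p) (inverse (real (Suc n)))" for n p
    have "\<exists>p. \<forall>n. good n (p n) \<and> \<rho> (fst (p (Suc n))) \<subseteq> \<rho> (fst (p n))"
    proof (rule dependent_nat_choice)
      show "\<exists>p. good 0 p"
      proof -
        obtain H x where "H \<in> \<F>" "\<rho> H \<subseteq> \<rho> F0" "f ` \<rho> H \<subseteq> mcball x 1"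
          using step[OF F0(1) order_refl zero_less_one] by metis
        then show ?thesis
          unfolding good_def by (intro exI[of _ "(H, x)"]) (simp del: in_mcball)
      qed
      show "\<exists>q. good (Suc n) q \<and> \<rho> (fst q) \<subseteq> \<rho> (fst p)" if "good n p" for p n
      proof -
        obtain H x where "H \<in> \<F>" "\<rho> H \<subseteq> \<rho> (fst p)" "f ` \<rho> H \<subseteq> mcball x (inverse (real (Suc (Suc n))))"
          using step[of "fst p" "inverse (real (Suc (Suc n)))"] \<open>good n p\<close> unfolding good_def
          by (metis inverse_positive_iff_positive of_nat_0_less_iff zero_less_Suc)
        then show ?thesis
          using \<open>good n p\<close> unfolding good_def by (intro exI[of _ "(H, x)"]) (simp del: in_mcball, blast)
      qed
    qed
    then obtain p where p: "\<And>n. good n (p n)" "\<And>n. \<rho> (fst (p (Suc n))) \<subseteq> \<rho> (fst (p n))"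
      by blast
    define S c where "S n = fst (p n)" and "c n = snd (p n)" for n
    have S: "S n \<in> \<F>" "\<rho> (S n) \<subseteq> \<rho> F0" "\<rho> (S (Suc n)) \<subseteq> \<rho> (S n)"
      "f ` \<rho> (S n) \<subseteq> mcball (c n) (inverse (real (Suc n)))" for n
      using p unfolding good_def S_def c_def by blast+
    have anti: "\<rho> (S n) \<subseteq> \<rho> (S i)" if "i \<le> n" for i n
      using lift_Suc_antimono_le[of "\<lambda>n. \<rho> (S n)"] S(3) that by blast
    obtain G where G: "G \<in> \<F>" "\<And>n. rho_almost_subset \<Omega> \<rho> G (\<rho> (S n))"
      using wp[of S] S by blast
    \<comment> \<open>The balls need not be nested, but their finite intersections are, and each
      contains \<open>f l\<close> for every \<open>l\<close> in \<open>\<rho> (S n)\<close>;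
      compactness gives a common point.\<close>
    define D where "D n = (\<Inter>i\<le>n. mcball (c i) (inverse (real (Suc i))))" for n
    have "\<Inter>(range D) \<noteq> {}"
    proof (rule compact_space_imp_nest)
      show "compact_space mtopology"
        using comp top by simp
      show "closedin mtopology (D n)" for n
        unfolding D_def by (intro closedin_Inter) auto
      show "D n \<noteq> {}" for n
      proof -
        obtain l where "l \<in> \<rho> (S n)"
          using infinite_rho[OF S(1)] by (metis finite.emptyI ex_in_conv)
        then have "f l \<in> D n"
          using S(4) anti unfolding D_def by fastforce
        then show ?thesis
          by blast
      qed
      show "decseq D"
        unfolding D_def by (rule decseq_SucI) auto
    qed
    then obtain x where x: "\<And>n. x \<in> mcball (c n) (inverse (real (Suc n)))"
      unfolding D_def by blast
    obtain K where K: "finite K" "K \<subseteq> \<Omega>" "\<rho> (G - K) \<subseteq> \<rho> (S 0)"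
      using G(2)[of 0] unfolding rho_almost_subset_def by blast
    have "rho_convergent_to \<Omega> \<rho> mtopology (G - K) f x"
      unfolding rho_convergent_to_def topspace_mtopology
    proof (intro conjI allI impI)
      show xm: "x \<in> mspace m"
        using x by auto
      fix U assume "openin mtopology U \<and> x \<in> U"
      then obtain e where e: "e > 0" "mball x e \<subseteq> U"
        unfolding openin_mtopology by blast
      \<comment> \<open>The ball about \<open>c n\<close> contains \<open>x\<close> without being
        centred there, so its points have distance at most two radii from \<open>x\<close>.\<close>
      obtain n where n: "inverse (real (Suc n)) < e / 2"
        using reals_Archimedean[of "e / 2"] e(1) by auto
      have "mcball (c n) (inverse (real (Suc n))) \<subseteq> mball x e"
      proof
        fix z assume z: "z \<in> mcball (c n) (inverse (real (Suc n)))"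
        have "mdist m x z \<le> mdist m x (c n) + mdist m (c n) z"
          using x[of n] z by (intro triangle) auto
        also have "\<dots> < e"
          using x[of n] z n by (auto simp: commute)
        finally show "z \<in> mball x e"
          using z xm by auto
      qed
      then have fU: "f ` \<rho> (S n) \<subseteq> U"
        using S(4)[of n] e(2) by blast
      obtain L where L: "finite L" "L \<subseteq> \<Omega>" "\<rho> (G - L) \<subseteq> \<rho> (S n)"
        using G(2)[of n] unfolding rho_almost_subset_def by blast
      have "\<rho> (G - K - L) \<subseteq> \<rho> (G - L)"
        using rho_Diff_antimono[OF G(1), of "K \<union> L" L] K L by (auto simp: Diff_eq Int_assoc)
      then have "f ` \<rho> (G - K - L) \<subseteq> U"
        using L(3) fU by blast
      then show "\<exists>L. finite L \<and> L \<subseteq> \<Omega> \<and> f ` \<rho> (G - K - L) \<subseteq> U"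
        using L by blast
    qed
    moreover have "G - K \<in> \<F>" "\<rho> (G - K) \<subseteq> \<rho> E"
      using family_Diff[OF G(1)] K S(2)[of 0] F0(2) by blast+
    ultimately show "\<exists>F\<in>\<F>. \<rho> F \<subseteq> \<rho> E \<and> (\<exists>x. rho_convergent_to \<Omega> \<rho> mtopology F f x)"
      by blast
  qed
qed

end

section \<open>Tall functions and Mrowka spaces\<close>

text \<open>The Mrowka and tower spaces live on types of their own, while the statement asks for
  points of a prescribed type; an injection carries the topology over.\<close>

lemma homeomorphic_copy:
  fixes X :: "'b topology"
  assumes "topspace X \<lesssim> (UNIV :: 'a set)"
  obtains Y :: "'a topology" where "X homeomorphic_space Y"
proof -
  obtain g :: "'b \<Rightarrow> 'a" where g: "inj_on g (topspace X)"
    using assms unfolding lepoll_def by blast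
  define h where "h = inv_into (topspace X) g"
  define Y where "Y = pullback_topology (g ` topspace X) h X"
  have hg: "h (g x) = x" if "x \<in> topspace X" for x
    using that g by (simp add: h_def)
  have topY: "topspace Y = g ` topspace X"
    using hg by (auto simp: Y_def topspace_pullback_topology)
  have "continuous_map X Y g"
    unfolding Y_def
  proof (rule continuous_map_pullback')
    show "continuous_map X X (h \<circ> g)"
      using hg by (intro continuous_map_eq[OF continuous_map_id]) auto
  qed auto
  moreover have "continuous_map Y X (id \<circ> h)"
    unfolding Y_def by (rule continuous_map_pullback) simp
  ultimately have "homeomorphic_maps X Y g h"
    unfolding homeomorphic_maps_def using hg topY by simp
  then show thesis
    using that unfolding homeomorphic_space_def by blast
qed

lemma homeomorphic_space_surjective_map:
  assumes "X homeomorphic_space Y"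
  obtains g where "continuous_map X Y g" "g ` topspace X = topspace Y"
proof -
  obtain g where "homeomorphic_map X Y g"
    using assms unfolding homeomorphic_space by blast
  then show thesis
    using that homeomorphic_imp_continuous_map homeomorphic_imp_surjective_map by blast
qed

lemma sequentially_compact_continuous_map_image:
  assumes X: "sequentially_compact_space X" and g: "continuous_map X Y g" "g ` topspace X = topspace Y"
  shows "sequentially_compact_space Y"
  unfolding sequentially_compact_space_def
proof (intro allI impI)
  fix s :: "nat \<Rightarrow> 'b" assume s: "range s \<subseteq> topspace Y"
  define t where "t = inv_into (topspace X) g \<circ> s"
  have t: "t n \<in> topspace X" "g (t n) = s n" for n
    using s g(2) by (auto simp: t_def image_subset_iff intro: inv_into_into f_inv_into_f)
  then obtain r l where r: "strict_mono r" "limitin X (t \<circ> r) l sequentially"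
    using X unfolding sequentially_compact_space_def by (metis image_subsetI)
  have "limitin Y (g \<circ> (t \<circ> r)) (g l) sequentially"
    using g(1) r(2) by (rule continuous_map_limit)
  moreover have "g \<circ> (t \<circ> r) = s \<circ> r"
    using t(2) by auto
  ultimately show "\<exists>r l. strict_mono r \<and> limitin Y (s \<circ> r) l sequentially"
    using r(1) by metis
qed

lemma (in partition_regular_function) BW_on_continuous_map_image:
  assumes X: "BW_on B X" and g: "continuous_map X Y g" "g ` topspace X = topspace Y"
  shows "BW_on B Y"
  unfolding BW_on_def
proof
  fix f assume f: "f \<in> B \<rightarrow> topspace Y"
  define t where "t = inv_into (topspace X) g \<circ> f"
  have t: "t l \<in> topspace X" "g (t l) = f l" if "l \<in> B" for l
    using that f g(2) by (auto simp: t_def Pi_iff intro!: inv_into_into f_inv_into_f)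
  then obtain F x where F: "F \<in> \<F>" "\<rho> F \<subseteq> B" and x: "rho_convergent_to \<Omega> \<rho> X F t x"
    using X unfolding BW_on_def by (metis Pi_I)
  have "rho_convergent_to \<Omega> \<rho> Y F f (g x)"
    unfolding rho_convergent_to_def
  proof (intro conjI allI impI)
    show "g x \<in> topspace Y"
      using x g(2) unfolding rho_convergent_to_def by (metis imageI)
    fix U assume U: "openin Y U \<and> g x \<in> U"
    then have "openin X {z \<in> topspace X. g z \<in> U}"
      using g(1) openin_continuous_map_preimage by blast
    then obtain K where K: "finite K" "K \<subseteq> \<Omega>" "t ` \<rho> (F - K) \<subseteq> {z \<in> topspace X. g z \<in> U}"
      using x U unfolding rho_convergent_to_def by (metis (no_types, lifting) mem_Collect_eq)
    have "\<rho> (F - K) \<subseteq> B"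
      using rho_Diff_subset[OF F(1) K(1,2)] F(2) by blast
    then have "f ` \<rho> (F - K) \<subseteq> U"
      using K(3) t(2) by (auto simp: image_subset_iff subset_iff)
    then show "\<exists>K. finite K \<and> K \<subseteq> \<Omega> \<and> f ` \<rho> (F - K) \<subseteq> U"
      using K(1,2) by metis
  qed
  then show "\<exists>F\<in>\<F>. \<rho> F \<subseteq> B \<and> (\<exists>x. rho_convergent_to \<Omega> \<rho> Y F f x)"
    using F by metis
qed

text \<open>A member of \<open>\<I>\<close> almost disjoint from all of a maximal family could be
  added, so it already belongs to the family; but it meets itself in an infinite set.\<close>

lemma maximal_almost_disjoint_subfamily:
  assumes "\<And>I. I \<in> \<I> \<Longrightarrow> infinite I"
  obtains \<A> where "\<A> \<subseteq> \<I>" "pairwise (\<lambda>A B. finite (A \<inter> B)) \<A>"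
    "\<And>I. I \<in> \<I> \<Longrightarrow> \<exists>A\<in>\<A>. infinite (I \<inter> A)"
proof -
  let ?Z = "{\<A>. \<A> \<subseteq> \<I> \<and> pairwise (\<lambda>A B. finite (A \<inter> B)) \<A>}"
  have "\<exists>\<A>\<in>?Z. \<forall>\<B>\<in>?Z. \<A> \<subseteq> \<B> \<longrightarrow> \<B> = \<A>"
  proof (rule subset_Zorn')
    fix \<C> assume C: "subset.chain ?Z \<C>"
    then have "\<Union>\<C> \<subseteq> \<I>"
      unfolding subset.chain_def by blast
    moreover have "pairwise (\<lambda>A B. finite (A \<inter> B)) (\<Union>\<C>)"
      using C unfolding subset_chain_def by (intro pairwise_chain_Union) (auto simp: chain_subset_def)
    ultimately show "\<Union>\<C> \<in> ?Z"
      by blast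
  qed
  then obtain \<A> where A: "\<A> \<subseteq> \<I>" "pairwise (\<lambda>A B. finite (A \<inter> B)) \<A>"
    and max: "\<And>\<B>. \<B> \<subseteq> \<I> \<Longrightarrow> pairwise (\<lambda>A B. finite (A \<inter> B)) \<B> \<Longrightarrow> \<A> \<subseteq> \<B> \<Longrightarrow> \<B> = \<A>"
    by auto
  have "\<exists>A\<in>\<A>. infinite (I \<inter> A)" if I: "I \<in> \<I>" for I
  proof (rule ccontr)
    assume c: "\<not> ?thesis"
    then have "insert I \<A> = \<A>"
      using A I by (intro max) (auto simp: pairwise_insert Int_commute)
    then have "infinite (I \<inter> I)" "I \<in> \<A>"
      using assms I by auto
    then show False
      using c by blast
  qed
  then show thesis
    using that A by blast
qed

text \<open>The points of the space are coded as subsets of \<open>\<Lambda>\<close>: the isolated points as singletons, the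
  members of the almost disjoint family as themselves, the point at infinity as the empty set.\<close>

definition mrowka_space :: "'l set \<Rightarrow> 'l set set \<Rightarrow> 'l set topology" where
  "mrowka_space \<Lambda> \<A> = topology (\<lambda>U. U \<subseteq> (\<lambda>l. {l}) ` \<Lambda> \<union> \<A> \<union> {{}} \<and>
     (\<forall>A\<in>U \<inter> \<A>. finite {l \<in> A. {l} \<notin> U}) \<and> ({} \<in> U \<longrightarrow> finite (\<A> - U)))"

lemma openin_mrowka_space:
  "openin (mrowka_space \<Lambda> \<A>) U \<longleftrightarrow> U \<subseteq> (\<lambda>l. {l}) ` \<Lambda> \<union> \<A> \<union> {{}} \<and>
     (\<forall>A\<in>U \<inter> \<A>. finite {l \<in> A. {l} \<notin> U}) \<and> ({} \<in> U \<longrightarrow> finite (\<A> - U))"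
proof -
  have "istopology (\<lambda>U. U \<subseteq> (\<lambda>l. {l}) ` \<Lambda> \<union> \<A> \<union> {{}} \<and>
     (\<forall>A\<in>U \<inter> \<A>. finite {l \<in> A. {l} \<notin> U}) \<and> ({} \<in> U \<longrightarrow> finite (\<A> - U)))" (is "istopology ?P")
    unfolding istopology_def
  proof (intro conjI allI impI ballI)
    fix S T assume S: "?P S" and T: "?P T"
    show "S \<inter> T \<subseteq> (\<lambda>l. {l}) ` \<Lambda> \<union> \<A> \<union> {{}}"
      using S by blast
    show "finite {l \<in> A. {l} \<notin> S \<inter> T}" if "A \<in> S \<inter> T \<inter> \<A>" for A
    proof -
      have "{l \<in> A. {l} \<notin> S \<inter> T} = {l \<in> A. {l} \<notin> S} \<union> {l \<in> A. {l} \<notin> T}"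
        by blast
      then show ?thesis
        using S T that by simp
    qed
    show "finite (\<A> - S \<inter> T)" if "{} \<in> S \<inter> T"
      using S T that by (simp add: Diff_Int)
  next
    fix \<K> assume K: "\<forall>K\<in>\<K>. ?P K"
    show "\<Union>\<K> \<subseteq> (\<lambda>l. {l}) ` \<Lambda> \<union> \<A> \<union> {{}}"
      using K by blast
    show "finite {l \<in> A. {l} \<notin> \<Union>\<K>}" if AK: "A \<in> \<Union>\<K> \<inter> \<A>" for A
    proof -
      obtain K where "K \<in> \<K>" "A \<in> K \<inter> \<A>"
        using AK by blast
      then have "finite {l \<in> A. {l} \<notin> K}"
        using K by blast
      then show ?thesis
        by (rule rev_finite_subset) (use \<open>K \<in> \<K>\<close> in blast)
    qed
    show "finite (\<A> - \<Union>\<K>)" if "{} \<in> \<Union>\<K>"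
    proof -
      obtain K where "K \<in> \<K>" "{} \<in> K"
        using \<open>{} \<in> \<Union>\<K>\<close> by blast
      then have "finite (\<A> - K)"
        using K by blast
      then show ?thesis
        by (rule rev_finite_subset) (use \<open>K \<in> \<K>\<close> in blast)
    qed
  qed
  then show ?thesis
    unfolding mrowka_space_def by (simp add: topology_inverse')
qed

lemma topspace_mrowka_space:
  assumes "\<Union>\<A> \<subseteq> \<Lambda>"
  shows "topspace (mrowka_space \<Lambda> \<A>) = (\<lambda>l. {l}) ` \<Lambda> \<union> \<A> \<union> {{}}"
proof
  show "topspace (mrowka_space \<Lambda> \<A>) \<subseteq> (\<lambda>l. {l}) ` \<Lambda> \<union> \<A> \<union> {{}}"
    using openin_topspace[of "mrowka_space \<Lambda> \<A>"] unfolding openin_mrowka_space by blast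
  have "openin (mrowka_space \<Lambda> \<A>) ((\<lambda>l. {l}) ` \<Lambda> \<union> \<A> \<union> {{}})"
    unfolding openin_mrowka_space
  proof (intro conjI ballI impI)
    fix A assume "A \<in> ((\<lambda>l. {l}) ` \<Lambda> \<union> \<A> \<union> {{}}) \<inter> \<A>"
    then have "{l \<in> A. {l} \<notin> (\<lambda>l. {l}) ` \<Lambda> \<union> \<A> \<union> {{}}} = {}"
      using assms by blast
    then show "finite {l \<in> A. {l} \<notin> (\<lambda>l. {l}) ` \<Lambda> \<union> \<A> \<union> {{}}}"
      by (simp only: finite.emptyI)
  next
    have "\<A> - ((\<lambda>l. {l}) ` \<Lambda> \<union> \<A> \<union> {{}}) = {}"
      by blast
    then show "finite (\<A> - ((\<lambda>l. {l}) ` \<Lambda> \<union> \<A> \<union> {{}}))"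
      by (simp only: finite.emptyI)
  qed simp
  then show "(\<lambda>l. {l}) ` \<Lambda> \<union> \<A> \<union> {{}} \<subseteq> topspace (mrowka_space \<Lambda> \<A>)"
    by (rule openin_subset)
qed

section \<open>The compactified Mrowka space\<close>

context partition_regular_function
begin

text \<open>A sequence repeating no value infinitely often either visits \<open>\<A>\<close>
  infinitely often and converges to infinity along those terms, or runs through infinitely many
  isolated points; these meet some \<open>A\<close> infinitely, and the corresponding terms converge
  to \<open>A\<close>.\<close>

lemma sequentially_compact_mrowka_space:
  assumes sub: "\<Union>\<A> \<subseteq> \<Lambda>" and mad: "\<And>M. M \<subseteq> \<Lambda> \<Longrightarrow> infinite M \<Longrightarrow> \<exists>A\<in>\<A>. infinite (M \<inter> A)"
  shows "sequentially_compact_space (mrowka_space \<Lambda> \<A>)"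
  unfolding sequentially_compact_space_def
proof (intro allI impI)
  let ?X = "mrowka_space \<Lambda> \<A>"
  fix s :: "nat \<Rightarrow> 'l set" assume s: "range s \<subseteq> topspace ?X"
  show "\<exists>r l. strict_mono r \<and> limitin ?X (s \<circ> r) l sequentially"
  proof (cases "\<exists>x. infinite (s -` {x})")
    case True
    then obtain x where x: "infinite (s -` {x})"
      by blast
    then obtain n where "s n = x"
      by (metis finite.emptyI ex_in_conv vimage_singleton_eq)
    then have "x \<in> topspace ?X"
      using s by blast
    then have "\<exists>r. strict_mono r \<and> limitin ?X (s \<circ> r) x sequentially"
      using x by (intro limitin_enumerate[OF x]) (auto intro: finite_subset[of _ "{}"])
    then show ?thesis
      by blast
  next
    case False
    then have fin: "finite (s -` D)" if "finite D" for D
    proof -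
      have "s -` D = (\<Union>x\<in>D. s -` {x})"
        by blast
      then show ?thesis
        using False that by auto
    qed
    show ?thesis
    proof (cases "infinite (s -` \<A>)")
      case True
      have "\<exists>r. strict_mono r \<and> limitin ?X (s \<circ> r) {} sequentially"
      proof (rule limitin_enumerate[OF True])
        show "{} \<in> topspace ?X"
          using sub by (simp add: topspace_mrowka_space)
        fix U assume "openin ?X U" "{} \<in> U"
        then have "finite (s -` (\<A> - U))"
          unfolding openin_mrowka_space by (intro fin) blast
        then show "finite {i \<in> s -` \<A>. s i \<notin> U}"
          by (rule rev_finite_subset) blast
      qed
      then show ?thesis
        by blast
    next
      case fA: False
      define M where "M = {l \<in> \<Lambda>. {l} \<in> range s}"
      have "infinite M"
      proof
        assume "finite M"
        then have "finite (s -` ((\<lambda>l. {l}) ` M \<union> {{}}) \<union> s -` \<A>)"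
          using fA fin[of "(\<lambda>l. {l}) ` M \<union> {{}}"] by simp
        moreover have "UNIV \<subseteq> s -` ((\<lambda>l. {l}) ` M \<union> {{}}) \<union> s -` \<A>"
          using s unfolding topspace_mrowka_space[OF sub] M_def by fastforce
        ultimately show False
          using infinite_UNIV_nat finite_subset by blast
      qed
      then obtain A where A: "A \<in> \<A>" "infinite (M \<inter> A)"
        using mad[of M] unfolding M_def by blast
      define N where "N = {i. \<exists>l\<in>A. s i = {l}}"
      have "(\<lambda>l. {l}) ` (M \<inter> A) \<subseteq> s ` N"
        unfolding M_def N_def by auto
      moreover have "infinite ((\<lambda>l. {l}) ` (M \<inter> A))"
        using A(2) by (simp add: finite_image_iff)
      ultimately have "infinite N"
        using finite_surj by blast
      then have "\<exists>r. strict_mono r \<and> limitin ?X (s \<circ> r) A sequentially"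
      proof (rule limitin_enumerate)
        show "A \<in> topspace ?X"
          using A sub by (simp add: topspace_mrowka_space)
        fix U assume "openin ?X U" "A \<in> U"
        then have "finite (s -` (\<lambda>l. {l}) ` {l \<in> A. {l} \<notin> U})"
          using A(1) unfolding openin_mrowka_space by (intro fin finite_imageI) blast
        then show "finite {i \<in> N. s i \<notin> U}"
          by (rule rev_finite_subset) (auto simp: N_def)
      qed
      then show ?thesis
        by blast
    qed
  qed
qed

text \<open>The embedding of \<open>\<Lambda>\<close> as the isolated points has no \<rho>-limit. An
  isolated limit would put an infinite set inside a singleton, a limit in \<open>\<A>\<close> would
  make that set positive, and a limit at infinity contradicts maximality.\<close>

lemma mrowka_space_not_BW:
  assumes sub: "\<Union>\<A> \<subseteq> \<Lambda>" and mad: "\<And>M. M \<subseteq> \<Lambda> \<Longrightarrow> infinite M \<Longrightarrow> \<exists>A\<in>\<A>. infinite (M \<inter> A)"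
    and ad: "pairwise (\<lambda>A B. finite (A \<inter> B)) \<A>"
    and null: "\<And>A. A \<in> \<A> \<Longrightarrow> infinite A \<and> \<not> pos A"
  shows "\<not> BW_on \<Lambda> (mrowka_space \<Lambda> \<A>)"
proof
  let ?X = "mrowka_space \<Lambda> \<A>"
  have top: "topspace ?X = (\<lambda>l. {l}) ` \<Lambda> \<union> \<A> \<union> {{}}"
    using sub by (rule topspace_mrowka_space)
  \<comment> \<open>The members of \<open>\<A>\<close> are infinite, so none is confused with the
    code of an isolated point or of infinity.\<close>
  have nsing: "{l} \<notin> \<A>" "{} \<notin> \<A>" for l
    using null by fastforce+
  assume BW: "BW_on \<Lambda> ?X"
  have "(\<lambda>l. {l}) \<in> \<Lambda> \<rightarrow> topspace ?X"
    by (auto simp: top)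
  then obtain F x where F: "F \<in> \<F>" and x: "rho_convergent_to \<Omega> \<rho> ?X F (\<lambda>l. {l}) x"
    using BW unfolding BW_on_def by blast
  have conv: "\<exists>K. finite K \<and> K \<subseteq> \<Omega> \<and> (\<lambda>l. {l}) ` \<rho> (F - K) \<subseteq> U" if "openin ?X U" "x \<in> U" for U
    using x that unfolding rho_convergent_to_def by metis
  have "x \<in> topspace ?X"
    using x unfolding rho_convergent_to_def by metis
  then consider l where "l \<in> \<Lambda>" "x = {l}" | "x \<in> \<A>" | "x = {}"
    unfolding top by blast
  then show False
  proof cases
    case 1
    then have "openin ?X {x}"
      unfolding openin_mrowka_space using nsing by auto
    then obtain K where K: "finite K" "K \<subseteq> \<Omega>" "(\<lambda>l. {l}) ` \<rho> (F - K) \<subseteq> {x}"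
      using conv by (metis insertI1)
    then have "\<rho> (F - K) \<subseteq> {l}"
      using 1(2) by blast
    then show False
      using infinite_rho[OF family_Diff[OF F K(1,2)]] finite_subset by blast
  next
    case 2
    let ?U = "insert x ((\<lambda>l. {l}) ` x)"
    have "{l \<in> x. {l} \<notin> ?U} = {}"
      by blast
    then have "openin ?X ?U"
      unfolding openin_mrowka_space using nsing 2 sub
      by (intro conjI ballI impI) (auto simp only: Int_insert_left_if1 finite.emptyI)
    then obtain K where K: "finite K" "K \<subseteq> \<Omega>" "(\<lambda>l. {l}) ` \<rho> (F - K) \<subseteq> ?U"
      using conv by (metis insertI1)
    have "\<rho> (F - K) \<subseteq> x"
      using K(3) 2 nsing(1) by blast
    then show False
      using null[OF 2] pos_mono[OF pos_rho[OF family_Diff[OF F K(1,2)]]] by blast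
  next
    case 3
    have esc: "\<exists>K. finite K \<and> K \<subseteq> \<Omega> \<and> \<rho> (F - K) \<inter> A = {}" if A: "A \<in> \<A>" for A
    proof -
      \<comment> \<open>Deleting \<open>A\<close> with its isolated points leaves a neighbourhood of
        infinity: only one member of the family is lost, and every other one meets \<open>A\<close>
        in a finite set.\<close>
      let ?U = "topspace ?X - insert A ((\<lambda>l. {l}) ` A)"
      have "finite {l \<in> B. {l} \<notin> ?U}" if "B \<in> ?U \<inter> \<A>" for B
      proof -
        have "{l \<in> B. {l} \<notin> ?U} \<subseteq> B \<inter> A"
          using that sub A nsing unfolding top by auto
        moreover have "finite (B \<inter> A)"
          using ad that A unfolding pairwise_def by blast
        ultimately show ?thesis
          by (rule finite_subset)
      qed
      moreover have "\<A> - ?U \<subseteq> {A}"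
        using nsing(1) unfolding top by auto
      then have "finite (\<A> - ?U)"
        by (rule finite_subset) simp
      ultimately have "openin ?X ?U"
        unfolding openin_mrowka_space by (auto simp: top)
      moreover have "x \<in> ?U"
        using 3 A nsing unfolding top by auto
      ultimately obtain K where K: "finite K" "K \<subseteq> \<Omega>" "(\<lambda>l. {l}) ` \<rho> (F - K) \<subseteq> ?U"
        using conv by metis
      then have "\<rho> (F - K) \<inter> A = {}"
        by blast
      then show ?thesis
        using K(1,2) by blast
    qed
    \<comment> \<open>A pseudointersection of the sets \<open>\<rho> (F - K)\<close> is almost
      disjoint from every \<open>A\<close>, yet as an infinite set it must meet one of them
      infinitely.\<close>
    obtain r :: "nat \<Rightarrow> nat" where r: "strict_mono r"
      "\<And>K. finite K \<Longrightarrow> K \<subseteq> \<Omega> \<Longrightarrow> \<exists>N. \<forall>n\<ge>N. r n \<in> to_nat_on \<Lambda> ` \<rho> (F - K)"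
      using rho_pseudointersection[OF F] by blast
    define e where "e = from_nat_into \<Lambda> \<circ> r"
    have "bij_betw (from_nat_into \<Lambda>) UNIV \<Lambda>"
      using countable_Lambda infinite_Lambda by (rule bij_betw_from_nat_into)
    then have "inj e" "range e \<subseteq> \<Lambda>"
      using r(1) unfolding e_def bij_betw_def by (auto intro!: inj_compose simp: strict_mono_imp_inj_on)
    then obtain A where A: "A \<in> \<A>" "infinite (range e \<inter> A)"
      using mad[of "range e"] range_inj_infinite by blast
    obtain K where K: "finite K" "K \<subseteq> \<Omega>" "\<rho> (F - K) \<inter> A = {}"
      using esc[OF A(1)] by metis
    obtain N where N: "\<And>n. n \<ge> N \<Longrightarrow> r n \<in> to_nat_on \<Lambda> ` \<rho> (F - K)"
      using r(2)[OF K(1,2)] by metis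
    have "e n \<notin> A" if n: "n \<ge> N" for n
    proof -
      obtain l where l: "l \<in> \<rho> (F - K)" "r n = to_nat_on \<Lambda> l"
        using N[OF n] by blast
      then have "e n = l"
        using rho_subset[OF family_Diff[OF F K(1,2)]] countable_Lambda unfolding e_def by auto
      then show ?thesis
        using l(1) K(3) by blast
    qed
    then have "range e \<inter> A \<subseteq> e ` {..<N}"
      by clarsimp (metis imageI lessThan_iff not_le)
    then show False
      using A(2) finite_subset by blast
  qed
qed

text \<open>The points of the Mrowka space are subsets of \<open>\<Lambda>\<close>, at most
  continuum many, which explains the size asked of the type \<open>'a\<close>.\<close>

lemma tall_imp_sequentially_compact_not_FinBW:
  assumes tall: "tall \<Lambda> \<F> \<rho>" and card: "(UNIV :: real set) \<lesssim> (UNIV :: 'a set)"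
  shows "\<exists>Y :: 'a topology. sequentially_compact_space Y \<and> Y \<notin> FinBW \<Lambda> \<Omega> \<F> \<rho>"
proof -
  let ?I = "{I. I \<subseteq> \<Lambda> \<and> infinite I \<and> \<not> pos I}"
  obtain \<A> where A: "\<A> \<subseteq> ?I" "pairwise (\<lambda>A B. finite (A \<inter> B)) \<A>"
    and max: "\<And>I. I \<in> ?I \<Longrightarrow> \<exists>A\<in>\<A>. infinite (I \<inter> A)"
    using maximal_almost_disjoint_subfamily[of ?I] by blast
  have sub: "\<Union>\<A> \<subseteq> \<Lambda>"
    using A(1) by blast
  have mad: "\<exists>A\<in>\<A>. infinite (M \<inter> A)" if M: "M \<subseteq> \<Lambda>" "infinite M" for M
  proof -
    obtain I where I: "I \<subseteq> M" "I \<in> ?I"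
      using tall M unfolding tall_def rho_ideal_iff by (metis (mono_tags, lifting) mem_Collect_eq)
    then obtain A where "A \<in> \<A>" "infinite (I \<inter> A)"
      using max by blast
    moreover have "I \<inter> A \<subseteq> M \<inter> A"
      using I(1) by blast
    ultimately show ?thesis
      using finite_subset by blast
  qed
  let ?X = "mrowka_space \<Lambda> \<A>"
  have "topspace ?X \<subseteq> Pow \<Lambda>"
    using sub by (auto simp: topspace_mrowka_space[OF sub])
  then have "topspace ?X \<lesssim> Pow \<Lambda>"
    by (rule subset_imp_lepoll)
  also have "Pow \<Lambda> \<lesssim> (UNIV :: nat set set)"
    unfolding lepoll_def using inj_on_image_Pow[OF inj_on_to_nat_on[OF countable_Lambda]] by blast
  also have "(UNIV :: nat set set) \<approx> (UNIV :: real set)"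
    by (rule nat_sets_eqpoll_reals)
  also note card
  finally obtain Y :: "'a topology" where Y: "?X homeomorphic_space Y"
    using homeomorphic_copy by blast
  have "sequentially_compact_space Y"
    using sequentially_compact_mrowka_space[OF sub mad] homeomorphic_space_surjective_map[OF Y]
      sequentially_compact_continuous_map_image by metis
  moreover have "\<not> BW_on \<Lambda> ?X"
    using A by (intro mrowka_space_not_BW sub mad) auto
  then have "\<not> BW_on \<Lambda> Y"
    using BW_on_continuous_map_image Y homeomorphic_space_sym homeomorphic_space_surjective_map by metis
  ultimately show ?thesis
    unfolding FinBW_iff by blast
qed

end

section \<open>The first uncountable ordinal\<close>

text \<open>Well-orders of type \<open>\<omega>\<^sub>1\<close>. Two of them are used:
  \<open>cardSuc natLeq\<close> for the ordinal space, and under the Continuum Hypothesis an order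
  of all reals, whose field is the whole type as the tower demands.\<close>

locale omega1_order =
  fixes r :: "'i rel"
  assumes well: "Well_order r" and uncountable_Field: "uncountable (Field r)"
    and countable_underS: "\<And>a. a \<in> Field r \<Longrightarrow> countable (underS r a)"
begin

lemma wo: "wo_rel r"
  using well by (simp add: wo_rel_def)

lemma refl_r: "a \<in> Field r \<Longrightarrow> (a, a) \<in> r"
  using wo_rel.REFL[OF wo] by (simp add: refl_on_def)

lemma trans_r: "(a, b) \<in> r \<Longrightarrow> (b, c) \<in> r \<Longrightarrow> (a, c) \<in> r"
  using wo_rel.TRANS[OF wo] by (meson transD)

lemma antisym_r: "(a, b) \<in> r \<Longrightarrow> (b, a) \<in> r \<Longrightarrow> a = b"
  using wo_rel.ANTISYM[OF wo] by (meson antisymD)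

lemma total_r: "a \<in> Field r \<Longrightarrow> b \<in> Field r \<Longrightarrow> (a, b) \<in> r \<or> (b, a) \<in> r"
  using wo_rel.TOTALS[OF wo] by blast

lemma not_le_r: "a \<in> Field r \<Longrightarrow> b \<in> Field r \<Longrightarrow> (a, b) \<notin> r \<longleftrightarrow> b \<in> underS r a"
  using total_r antisym_r refl_r unfolding underS_def by auto

lemma wf_r: "wf (r - Id)"
  using well unfolding well_order_on_def by blast

lemma least_r:
  assumes "a \<in> Field r" "P a"
  obtains m where "m \<in> Field r" "P m" "\<And>b. b \<in> underS r m \<Longrightarrow> \<not> P b"
proof -
  obtain m where m: "m \<in> {a \<in> Field r. P a}" "\<And>b. (b, m) \<in> r - Id \<Longrightarrow> b \<notin> {a \<in> Field r. P a}"
    using wfE_min[OF wf_r, of a "{a \<in> Field r. P a}"] assms by blast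
  have "\<not> P b" if "b \<in> underS r m" for b
    using m(2)[of b] that unfolding underS_def by (auto simp: Field_def)
  then show thesis
    using that m(1) by blast
qed

text \<open>Regularity of \<open>\<omega>\<^sub>1\<close>: an unbounded countable \<open>N\<close>
  would cover the field by countably many countable initial segments.\<close>

lemma countable_bounded:
  assumes "countable N" "N \<subseteq> Field r"
  shows "\<exists>c\<in>Field r. \<forall>a\<in>N. (a, c) \<in> r"
proof (rule ccontr)
  assume c: "\<not> ?thesis"
  have "Field r \<subseteq> (\<Union>a\<in>N. underS r a)"
  proof
    fix c assume "c \<in> Field r"
    then obtain a where "a \<in> N" "(a, c) \<notin> r"
      using c by blast
    then show "c \<in> (\<Union>a\<in>N. underS r a)"
      using not_le_r[of a c] \<open>c \<in> Field r\<close> assms(2) by blast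
  qed
  moreover have "countable (\<Union>a\<in>N. underS r a)"
    using assms countable_underS by (intro countable_UN) auto
  ultimately show False
    using uncountable_Field countable_subset by blast
qed

lemma ex_above:
  assumes "a \<in> Field r"
  shows "\<exists>b\<in>Field r. a \<in> underS r b"
proof (rule ccontr)
  assume c: "\<not> ?thesis"
  have "Field r \<subseteq> insert a (underS r a)"
  proof
    fix x assume x: "x \<in> Field r"
    then have "a \<notin> underS r x"
      using c by blast
    then show "x \<in> insert a (underS r a)"
      using not_le_r[OF assms x] by (auto simp: underS_def)
  qed
  moreover have "countable (insert a (underS r a))"
    using countable_underS[OF assms] by simp
  ultimately show False
    using uncountable_Field countable_subset by blast
qed

section \<open>The order topology\<close>

lemma topspace_order_topology: "topspace (order_topology_on r) = Field r"
  unfolding order_topology_on_def by (auto simp: underS_def aboveS_def Field_def)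

lemma openin_underS: "a \<in> Field r \<Longrightarrow> openin (order_topology_on r) (underS r a)"
  and openin_aboveS: "a \<in> Field r \<Longrightarrow> openin (order_topology_on r) (aboveS r a)"
  unfolding order_topology_on_def by (auto intro!: topology_generated_by_Basis)

lemma not_compact_order_topology: "\<not> compact_space (order_topology_on r)"
proof
  assume comp: "compact_space (order_topology_on r)"
  have "(\<forall>U\<in>underS r ` Field r. openin (order_topology_on r) U) \<and> Field r \<subseteq> \<Union>(underS r ` Field r)"
    using openin_underS ex_above by blast
  then obtain \<V> where V: "finite \<V>" "\<V> \<subseteq> underS r ` Field r" "Field r \<subseteq> \<Union>\<V>"
    using comp unfolding compact_space_alt topspace_order_topology by meson
  have "countable (\<Union>V\<in>\<V>. V)"
    using V(1,2) countable_underS by (intro countable_UN) (auto intro: countable_finite)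
  then show False
    using V(3) uncountable_Field countable_subset by auto
qed

lemma Hausdorff_order_topology: "Hausdorff_space (order_topology_on r)"
proof -
  have sep: "\<exists>U V. openin (order_topology_on r) U \<and> openin (order_topology_on r) V \<and>
      a \<in> U \<and> b \<in> V \<and> disjnt U V"
    if ab: "a \<in> Field r" "b \<in> Field r" "(a, b) \<in> r" "a \<noteq> b" for a b
  \<comment> \<open>A point strictly between \<open>a\<close> and \<open>b\<close> serves as the
    cut; across a jump the two open rays are already disjoint.\<close>
  proof (cases "\<exists>c. a \<in> underS r c \<and> c \<in> underS r b")
    case True
    then obtain c where c: "a \<in> underS r c" "c \<in> underS r b"
      by blast
    then have "c \<in> Field r" "b \<in> aboveS r c"
      by (auto simp: underS_def aboveS_def Field_def)
    moreover have "disjnt (underS r c) (aboveS r c)"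
      using antisym_r by (auto simp: disjnt_def underS_def aboveS_def)
    ultimately show ?thesis
      using openin_underS openin_aboveS c(1) by blast
  next
    case False
    have "disjnt (underS r b) (aboveS r a)"
      using False by (auto simp: disjnt_def underS_def aboveS_def)
    moreover have "a \<in> underS r b" "b \<in> aboveS r a"
      using ab by (auto simp: underS_def aboveS_def)
    ultimately show ?thesis
      using openin_underS openin_aboveS ab(1,2) by blast
  qed
  show ?thesis
    unfolding Hausdorff_space_def topspace_order_topology
  proof (intro allI impI)
    fix x y assume xy: "x \<in> Field r \<and> y \<in> Field r \<and> x \<noteq> y"
    then consider "(x, y) \<in> r" | "(y, x) \<in> r"
      using total_r by blast
    then show "\<exists>U V. openin (order_topology_on r) U \<and> openin (order_topology_on r) V \<and>
        x \<in> U \<and> y \<in> V \<and> disjnt U V"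
    proof cases
      case 1
      then show ?thesis
        using sep xy by blast
    next
      case 2
      then show ?thesis
        using sep[of y x] xy disjnt_sym by metis
    qed
  qed
qed

end

section \<open>Two realisations of \<open>\<omega>\<^sub>1\<close>\<close>

lemma omega1_order_cardSuc_natLeq:
  includes cardinal_syntax
  shows "omega1_order (cardSuc natLeq)"
proof
  have card: "Card_order (cardSuc natLeq)"
    by (rule cardSuc_Card_order[OF natLeq_Card_order])
  show "Well_order (cardSuc natLeq)"
    using card by (simp add: card_order_on_def)
  have "natLeq <o |Field (cardSuc natLeq)|"
    using cardSuc_greater[OF natLeq_Card_order] card_of_Field_ordIso[OF card]
      ordIso_symmetric ordLess_ordIso_trans by blast
  then show "uncountable (Field (cardSuc natLeq))"
    unfolding countable_card_le_natLeq using not_ordLess_ordLeq by blast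
  show "countable (underS (cardSuc natLeq) a)" if "a \<in> Field (cardSuc natLeq)" for a
    using card_of_underS[OF card that]
      cardSuc_ordLeq_ordLess[OF natLeq_Card_order card_of_Card_order[of "underS (cardSuc natLeq) a"]]
    unfolding countable_card_le_natLeq by blast
qed

text \<open>Proper initial segments of a cardinal well-order have smaller cardinality, and under the
  Continuum Hypothesis a set of reals smaller than the continuum is countable.\<close>

lemma omega1_order_reals:
  includes cardinal_syntax
  assumes "continuum_hypothesis"
  shows "omega1_order |UNIV :: real set|"
proof
  have card: "Card_order |UNIV :: real set|"
    by (rule card_of_Card_order)
  show "Well_order |UNIV :: real set|"
    by (rule card_of_Well_order)
  show "uncountable (Field |UNIV :: real set| )"
    by (simp add: Field_card_of uncountable_UNIV_real)
  show "countable (underS |UNIV :: real set| a)" if "a \<in> Field |UNIV :: real set|" for a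
  proof (rule ccontr)
    assume "uncountable (underS |UNIV :: real set| a)"
    then have "underS |UNIV :: real set| a \<approx> (UNIV :: real set)"
      using assms unfolding continuum_hypothesis_def by blast
    then have "|underS |UNIV :: real set| a| =o |UNIV :: real set|"
      unfolding eqpoll_def card_of_ordIso .
    then show False
      using card_of_underS[OF card that] not_ordLess_ordIso by blast
  qed
qed

text \<open>A bound exists because \<open>\<Lambda>\<close> is countable. The diagonal property is
  applied to \<open>D a\<close>, which may be a proper subset of \<open>\<Lambda>\<close>, hence
  \<open>P_minus\<close> in full.\<close>

lemma (in partition_regular_function) P_minus_order_topology:
  assumes P: "P_minus \<Lambda> \<Omega> \<F> \<rho>" and r: "omega1_order r"
  shows "order_topology_on r \<in> FinBW \<Lambda> \<Omega> \<F> \<rho>"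
  unfolding FinBW_iff BW_on_def
proof
  interpret omega1_order r by fact
  let ?X = "order_topology_on r"
  fix f assume "f \<in> \<Lambda> \<rightarrow> topspace ?X"
  then have f: "\<And>l. l \<in> \<Lambda> \<Longrightarrow> f l \<in> Field r"
    unfolding topspace_order_topology by blast
  define D where "D a = {l \<in> \<Lambda>. (f l, a) \<in> r}" for a
  obtain c where c: "c \<in> Field r" "\<And>l. l \<in> \<Lambda> \<Longrightarrow> (f l, c) \<in> r"
    using countable_bounded[of "f ` \<Lambda>"] countable_Lambda f by auto
  then have "D c = \<Lambda>"
    unfolding D_def by blast
  then have "pos (D c)"
    using pos_Lambda by simp
  then obtain a where a: "a \<in> Field r" "pos (D a)" and least: "\<And>b. b \<in> underS r a \<Longrightarrow> \<not> pos (D b)"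
    using least_r[of c "\<lambda>a. pos (D a)"] c(1) by blast
  have "D a \<subseteq> \<Lambda>"
    unfolding D_def by blast
  then have "diagonal (D a)"
    using P a(2) unfolding P_minus_iff by simp
  moreover have "countable (D ` underS r a)"
    using countable_underS[OF a(1)] by simp
  moreover have "\<not> pos (D a \<inter> C)" if "C \<in> D ` underS r a" for C
    using that least pos_mono[of "D a \<inter> C" C] by blast
  ultimately obtain F where F: "F \<in> \<F>" "\<rho> F \<subseteq> D a"
    and esc: "\<And>\<D>. finite \<D> \<Longrightarrow> \<D> \<subseteq> D ` underS r a \<Longrightarrow>
      \<exists>K. finite K \<and> K \<subseteq> \<Omega> \<and> \<rho> (F - K) \<inter> \<Union>\<D> = {}"
    using diagonal_countable by metis
  have sub: "\<rho> (F - K) \<subseteq> D a" if "finite K" "K \<subseteq> \<Omega>" for K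
    using rho_Diff_subset[OF F(1) that] F(2) by blast
  \<comment> \<open>Only subbasic sets need thought: lower rays about \<open>a\<close> are reached
    because \<open>\<rho> F\<close> lies in \<open>D a\<close>, upper rays from \<open>b\<close> by
    escaping the null set \<open>D b\<close>.\<close>
  have gen: "\<exists>K. finite K \<and> K \<subseteq> \<Omega> \<and> f ` \<rho> (F - K) \<subseteq> U"
    if "generate_topology_on ({Field r} \<union> underS r ` Field r \<union> aboveS r ` Field r) U" "a \<in> U" for U
    using that
  proof (induction rule: generate_topology_on.induct)
    case (Int U V)
    then obtain K L where K: "finite K" "K \<subseteq> \<Omega>" "f ` \<rho> (F - K) \<subseteq> U"
      and L: "finite L" "L \<subseteq> \<Omega>" "f ` \<rho> (F - L) \<subseteq> V"
      by (metis IntD1 IntD2)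
    have KL: "finite (K \<union> L)" "K \<union> L \<subseteq> \<Omega>"
      using K L by auto
    have "\<rho> (F - (K \<union> L)) \<subseteq> \<rho> (F - K)" "\<rho> (F - (K \<union> L)) \<subseteq> \<rho> (F - L)"
      by (rule rho_Diff_antimono[OF F(1) KL]; blast)+
    then have "f ` \<rho> (F - (K \<union> L)) \<subseteq> U \<inter> V"
      using K(3) L(3) by blast
    then show ?case
      using KL by metis
  next
    case (UN \<K>)
    then show ?case
      by (metis UnionE Union_upper subset_trans)
  next
    case (Basis U)
    then consider "U = Field r" | b where "b \<in> Field r" "U = underS r b"
      | b where "b \<in> Field r" "U = aboveS r b"
      by blast
    then show ?case
    proof cases
      case 1
      then show ?thesis
        using F rho_subset f by (intro exI[of _ "{}"]) auto
    next
      case 2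
      have "f l \<in> underS r b" if "l \<in> \<rho> F" for l
      proof -
        have la: "(f l, a) \<in> r"
          using that F(2) unfolding D_def by blast
        have ab: "(a, b) \<in> r" "a \<noteq> b"
          using Basis 2 by (auto simp: underS_def)
        have "(f l, b) \<in> r"
          using trans_r[OF la ab(1)] .
        moreover have "f l \<noteq> b"
          using la ab antisym_r by blast
        ultimately show ?thesis
          by (simp add: underS_def)
      qed
      then show ?thesis
        using 2 by (intro exI[of _ "{}"]) auto
    next
      case 3
      then have b: "b \<in> underS r a"
        using Basis by (auto simp: underS_def aboveS_def)
      then obtain K where K: "finite K" "K \<subseteq> \<Omega>" "\<rho> (F - K) \<inter> \<Union>{D b} = {}"
        using esc[of "{D b}"] by auto
      have "f l \<in> aboveS r b" if l: "l \<in> \<rho> (F - K)" for l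
      proof -
        have "l \<in> \<Lambda>" "l \<notin> D b"
          using l K(3) sub[OF K(1,2)] unfolding D_def by auto
        then have "(f l, b) \<notin> r"
          unfolding D_def by blast
        then have "b \<in> underS r (f l)"
          using not_le_r f \<open>l \<in> \<Lambda>\<close> 3(1) by blast
        then show ?thesis
          by (auto simp: underS_def aboveS_def)
      qed
      then show ?thesis
        using K(1,2) 3 by (intro exI[of _ K]) auto
    qed
  qed auto
  have "rho_convergent_to \<Omega> \<rho> ?X F f a"
    unfolding rho_convergent_to_def
  proof (intro conjI allI impI)
    show "a \<in> topspace ?X"
      using a(1) by (simp add: topspace_order_topology)
    fix U assume "openin ?X U \<and> a \<in> U"
    then show "\<exists>K. finite K \<and> K \<subseteq> \<Omega> \<and> f ` \<rho> (F - K) \<subseteq> U"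
      using gen unfolding order_topology_on_def openin_topology_generated_by_iff by blast
  qed
  then show "\<exists>F\<in>\<F>. \<rho> F \<subseteq> \<Lambda> \<and> (\<exists>x. rho_convergent_to \<Omega> \<rho> ?X F f x)"
    using F(1) rho_subset[OF F(1)] by blast
qed

section \<open>Towers\<close>

lemma almost_chain_has_max:
  assumes "finite B" "B \<noteq> {}"
    and "\<And>b c. b \<in> B \<Longrightarrow> c \<in> B \<Longrightarrow> finite (T b - T c) \<or> finite (T c - T b)"
  shows "\<exists>m\<in>B. \<forall>b\<in>B. finite (T b - T m)"
  using assms
proof (induction B rule: finite_ne_induct)
  case (singleton x)
  then show ?case
    by simp
next
  case (insert x B)
  then obtain m where m: "m \<in> B" "\<And>b. b \<in> B \<Longrightarrow> finite (T b - T m)"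
    by blast
  show ?case
  proof (cases "finite (T x - T m)")
    case True
    then show ?thesis
      using m by blast
  next
    case False
    then have fin: "finite (T m - T x)"
      using insert.prems[of x m] m(1) by blast
    have "finite (T b - T x)" if "b \<in> B" for b
    proof -
      have "T b - T x \<subseteq> (T b - T m) \<union> (T m - T x)"
        by blast
      then show ?thesis
        using m(2)[OF that] fin finite_subset by blast
    qed
    then show ?thesis
      by auto
  qed
qed

text \<open>A finite almost chain has an almost largest member, so removing the whole union removes
  only finitely many points beyond that member.\<close>

lemma infinite_Diff_almost_chain:
  assumes "finite B" and "infinite Y" and "\<And>b. b \<in> B \<Longrightarrow> infinite (Y - T b)"
    and "\<And>b c. b \<in> B \<Longrightarrow> c \<in> B \<Longrightarrow> finite (T b - T c) \<or> finite (T c - T b)"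
  shows "infinite (Y - (\<Union>b\<in>B. T b))"
proof (cases "B = {}")
  case False
  then obtain m where m: "m \<in> B" "\<And>b. b \<in> B \<Longrightarrow> finite (T b - T m)"
    using almost_chain_has_max[of B T] assms(1,4) by blast
  have "finite (\<Union>b\<in>B. T b - T m)"
    using assms(1) m(2) by blast
  then have "infinite ((Y - T m) - (\<Union>b\<in>B. T b - T m))"
    using assms(3)[OF m(1)] by (rule Diff_infinite_finite)
  moreover have "(Y - T m) - (\<Union>b\<in>B. T b - T m) \<subseteq> Y - (\<Union>b\<in>B. T b)"
    by blast
  ultimately show ?thesis
    using finite_subset by blast
qed (use assms in simp)

text \<open>Diagonalisation: finitely many members never almost cover \<omega>, so a sequence can
  leave the first \<open>n\<close> of them at step \<open>n\<close>; its even and odd terms give the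
  two sets.\<close>

lemma almost_chain_split:
  fixes f :: "'i \<Rightarrow> nat set"
  assumes "countable B" and "\<And>b. b \<in> B \<Longrightarrow> infinite (- f b)"
    and "\<And>b c. b \<in> B \<Longrightarrow> c \<in> B \<Longrightarrow> finite (f b - f c) \<or> finite (f c - f b)"
  shows "\<exists>P Q. infinite P \<and> infinite Q \<and> P \<inter> Q = {} \<and>
    (\<forall>b\<in>B. finite (P \<inter> f b) \<and> finite (Q \<inter> f b))"
proof -
  define e where "e = from_nat_into (insert {} (f ` B))"
  have e: "range e = insert {} (f ` B)"
    unfolding e_def using assms(1) by simp
  have inf: "infinite (- (\<Union>i<n. e i))" for n
  proof -
    \<comment> \<open>The padding set need not be a value of \<open>f\<close>, so it is dropped
      before finitely many indices are selected.\<close>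
    have "e ` {..<n} - {{}} \<subseteq> f ` B"
      using e by blast
    then obtain D where D: "D \<subseteq> B" "finite D" "e ` {..<n} - {{}} = f ` D"
      using finite_subset_image[of "e ` {..<n} - {{}}" f B] by auto
    have "infinite (UNIV - (\<Union>b\<in>D. f b))"
    proof (rule infinite_Diff_almost_chain[OF D(2)])
      show "infinite (UNIV - f b)" if "b \<in> D" for b
        using assms(2)[of b] D(1) that by (auto simp: Compl_eq_Diff_UNIV)
      show "finite (f b - f c) \<or> finite (f c - f b)" if "b \<in> D" "c \<in> D" for b c
        using assms(3)[of b c] D(1) that by blast
    qed simp
    moreover have "(\<Union>i<n. e i) = (\<Union>b\<in>D. f b)"
    proof -
      have "(\<Union>i<n. e i) = \<Union>(e ` {..<n} - {{}})"
        by blast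
      then show ?thesis
        using D(3) by simp
    qed
    ultimately show ?thesis
      by (simp add: Compl_eq_Diff_UNIV)
  qed
  obtain r where r: "strict_mono r" "\<And>n. r n \<in> - (\<Union>i<n. e i)"
    using infinite_sets_strict_mono_choice[of "\<lambda>n. - (\<Union>i<n. e i)"] inf by blast
  have inj: "inj r"
    using r(1) by (simp add: strict_mono_imp_inj_on)
  have fin: "finite (range r \<inter> f b)" if b: "b \<in> B" for b
  proof -
    have "f b \<in> range e"
      using b e by blast
    then obtain i where i: "f b = e i"
      by blast
    have "r n \<notin> f b" if "n > i" for n
      using r(2)[of n] that i by auto
    then have "range r \<inter> f b \<subseteq> r ` {..i}"
      by clarsimp (metis atMost_iff imageI not_le)
    then show ?thesis
      using finite_subset by blast
  qed
  define P Q where "P = range (\<lambda>n. r (2 * n))" and "Q = range (\<lambda>n. r (2 * n + 1))"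
  have "infinite P" "infinite Q"
    unfolding P_def Q_def by (intro range_inj_infinite injI; drule injD[OF inj]; simp)+
  moreover have "P \<inter> Q = {}"
  proof -
    have "r (2 * m) \<noteq> r (2 * n + 1)" for m n
      using injD[OF inj, of "2 * m" "2 * n + 1"] by presburger
    then show ?thesis
      unfolding P_def Q_def by auto
  qed
  moreover have "finite (P \<inter> f b)" "finite (Q \<inter> f b)" if "b \<in> B" for b
  proof -
    have "P \<inter> f b \<subseteq> range r \<inter> f b" "Q \<inter> f b \<subseteq> range r \<inter> f b"
      unfolding P_def Q_def by auto
    then show "finite (P \<inter> f b)" "finite (Q \<inter> f b)"
      using finite_subset[OF _ fin[OF that]] by blast+
  qed
  ultimately show ?thesis
    by metis
qed

text \<open>Strict growth and infinite complements guarantee that neighbourhoods of points outside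
  \<omega> keep meeting \<omega>; separability rests on this.\<close>

locale tower = omega1_order r for r :: "'i rel" +
  fixes T :: "'i \<Rightarrow> nat set"
  assumes Field_UNIV: "Field r = UNIV"
    and infinite_T: "infinite (T a)" and coinfinite_T: "infinite (- T a)"
    and T_almost_mono: "b \<in> underS r a \<Longrightarrow> finite (T b - T a)"
    and T_strict: "b \<in> underS r a \<Longrightarrow> infinite (T a - T b)"
begin

lemma T_chain: "finite (T b - T c) \<or> finite (T c - T b)"
  using total_r[of b c] T_almost_mono unfolding Field_UNIV underS_def by (cases "b = c") auto

definition block :: "'i \<Rightarrow> (nat + 'i option) set" where
  "block a = Inl ` T a \<union> (Inr \<circ> Some) ` under r a"

text \<open>\<open>None\<close> is treated as an index above all others, so one formula describes
  the neighbourhoods of the top and of the remaining points \<open>Inr p\<close>: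
  \<open>seg p\<close> is the largest of them, \<open>preds p\<close> indexes the blocks that may be
  removed.\<close>

definition seg :: "'i option \<Rightarrow> (nat + 'i option) set" where
  "seg p = (case p of None \<Rightarrow> UNIV | Some a \<Rightarrow> block a)"

definition preds :: "'i option \<Rightarrow> 'i set" where
  "preds p = (case p of None \<Rightarrow> UNIV | Some a \<Rightarrow> underS r a)"

text \<open>No condition is put on points \<open>Inl n\<close>, so they are isolated. Discarding the
  finite set \<open>k\<close> absorbs the finite errors in the almost inclusions of the
  tower.\<close>

definition tower_open :: "(nat + 'i option) set \<Rightarrow> bool" where
  "tower_open U \<longleftrightarrow> (\<forall>p. Inr p \<in> U \<longrightarrow>
    (\<exists>B k. finite B \<and> B \<subseteq> preds p \<and> finite k \<and> seg p - (\<Union>b\<in>B. block b) - Inl ` k \<subseteq> U))"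

text \<open>The set \<open>\<omega> \<union> (\<omega>\<^sub>1 + 1)\<close>, in which the tower makes all the blocks \<open>T a \<union> [0,a]\<close> clopen
  (a Franklin-Rajagopalan space); \<open>Inr None\<close> is the top point \<open>\<omega>\<^sub>1\<close>.\<close>

definition tower_space :: "(nat + 'i option) topology" where
  "tower_space = topology tower_open"

lemma openin_tower_space: "openin tower_space U \<longleftrightarrow> tower_open U"
proof -
  have "istopology tower_open"
    unfolding istopology_def
  proof (intro conjI allI impI)
    fix S U assume S: "tower_open S" and U: "tower_open U"
    show "tower_open (S \<inter> U)"
      unfolding tower_open_def
    proof (intro allI impI)
      fix p assume p: "Inr p \<in> S \<inter> U"
      obtain B k where B: "finite B" "B \<subseteq> preds p" "finite k" "seg p - (\<Union>b\<in>B. block b) - Inl ` k \<subseteq> S"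
        using S p unfolding tower_open_def by (metis IntD1)
      obtain C j where C: "finite C" "C \<subseteq> preds p" "finite j" "seg p - (\<Union>b\<in>C. block b) - Inl ` j \<subseteq> U"
        using U p unfolding tower_open_def by (metis IntD2)
      have "seg p - (\<Union>b\<in>B \<union> C. block b) - Inl ` (k \<union> j) \<subseteq> S \<inter> U"
        using B(4) C(4) by blast
      then show "\<exists>B k. finite B \<and> B \<subseteq> preds p \<and> finite k \<and>
          seg p - (\<Union>b\<in>B. block b) - Inl ` k \<subseteq> S \<inter> U"
        using B C by (intro exI[of _ "B \<union> C"] exI[of _ "k \<union> j"] conjI) auto
    qed
  next
    fix \<K> assume K: "\<forall>K\<in>\<K>. tower_open K"
    show "tower_open (\<Union>\<K>)"
      unfolding tower_open_def
    proof (intro allI impI)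
      fix p assume "Inr p \<in> \<Union>\<K>"
      then obtain K where "K \<in> \<K>" "Inr p \<in> K"
        by blast
      then obtain B k where "finite B" "B \<subseteq> preds p" "finite k" "seg p - (\<Union>b\<in>B. block b) - Inl ` k \<subseteq> K"
        using K unfolding tower_open_def by metis
      moreover have "K \<subseteq> \<Union>\<K>"
        using \<open>K \<in> \<K>\<close> by blast
      ultimately show "\<exists>B k. finite B \<and> B \<subseteq> preds p \<and> finite k \<and>
          seg p - (\<Union>b\<in>B. block b) - Inl ` k \<subseteq> \<Union>\<K>"
        by (meson subset_trans)
    qed
  qed
  then show ?thesis
    unfolding tower_space_def by (simp add: topology_inverse')
qed

lemma tower_openI:
  assumes "\<And>p. Inr p \<in> U \<Longrightarrow> \<exists>B k. finite B \<and> B \<subseteq> preds p \<and> finite k \<and>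
    seg p \<subseteq> U \<union> (\<Union>b\<in>B. block b) \<union> Inl ` k"
  shows "openin tower_space U"
  unfolding openin_tower_space tower_open_def
proof (intro allI impI)
  fix p assume "Inr p \<in> U"
  then obtain B k where "finite B" "B \<subseteq> preds p" "finite k" "seg p \<subseteq> U \<union> (\<Union>b\<in>B. block b) \<union> Inl ` k"
    using assms by meson
  then show "\<exists>B k. finite B \<and> B \<subseteq> preds p \<and> finite k \<and> seg p - (\<Union>b\<in>B. block b) - Inl ` k \<subseteq> U"
    by (intro exI[of _ B] exI[of _ k] conjI) auto
qed

lemma topspace_tower_space: "topspace tower_space = UNIV"
proof -
  have "openin tower_space UNIV"
    by (rule tower_openI) (auto intro!: exI[of _ "{}"])
  then show ?thesis
    using openin_subset by blast
qed

lemma Inr_in_block: "Inr p \<in> block a \<longleftrightarrow> (\<exists>c. p = Some c \<and> (c, a) \<in> r)"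
  and Inl_in_block: "Inl n \<in> block a \<longleftrightarrow> n \<in> T a"
  unfolding block_def under_def by auto

text \<open>An earlier block sticks out of \<open>block a\<close> only in the finite set
  \<open>T c - T a\<close>, which a neighbourhood may omit.\<close>

lemma openin_block: "openin tower_space (block a)"
proof (rule tower_openI)
  fix p assume "Inr p \<in> block a"
  then obtain c where c: "p = Some c" "(c, a) \<in> r"
    by (auto simp: Inr_in_block)
  have "finite (T c - T a)"
    using T_almost_mono[of c a] c(2) by (cases "c = a") (auto simp: underS_def)
  moreover have "block c \<subseteq> block a \<union> Inl ` (T c - T a)"
  proof
    fix z assume z: "z \<in> block c"
    show "z \<in> block a \<union> Inl ` (T c - T a)"
    proof (cases z)
      case (Inl n)
      then show ?thesis
        using z by (auto simp: Inl_in_block)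
    next
      case (Inr q)
      then show ?thesis
        using z c(2) trans_r by (auto simp: Inr_in_block)
    qed
  qed
  ultimately show "\<exists>B k. finite B \<and> B \<subseteq> preds p \<and> finite k \<and>
      seg p \<subseteq> block a \<union> (\<Union>b\<in>B. block b) \<union> Inl ` k"
    using c(1) by (intro exI[of _ "{}"] exI[of _ "T c - T a"]) (auto simp: seg_def)
qed

text \<open>A point \<open>Inr p\<close> outside \<open>block a\<close> lies above \<open>a\<close>,
  so \<open>block a\<close> is among the sets that may be removed around it.\<close>

lemma openin_Compl_block: "openin tower_space (- block a)"
proof (rule tower_openI)
  fix p assume p: "Inr p \<in> - block a"
  have "a \<in> preds p"
  proof (cases p)
    case (Some c)
    then have "(c, a) \<notin> r"
      using p by (auto simp: Inr_in_block)
    then show ?thesis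
      using Some not_le_r[of c a] Field_UNIV by (simp add: preds_def)
  qed (simp add: preds_def)
  then show "\<exists>B k. finite B \<and> B \<subseteq> preds p \<and> finite k \<and>
      seg p \<subseteq> - block a \<union> (\<Union>b\<in>B. block b) \<union> Inl ` k"
    by (intro exI[of _ "{a}"] exI[of _ "{}"]) auto
qed

lemma openin_isolated: "openin tower_space {Inl n}" "openin tower_space (- {Inl n})"
proof -
  show "openin tower_space {Inl n}"
    by (rule tower_openI) auto
  show "openin tower_space (- {Inl n})"
    by (rule tower_openI) (auto intro!: exI[of _ "{}"] exI[of _ "{n}"])
qed

lemma Hausdorff_tower_space: "Hausdorff_space tower_space"
proof -
  have clopen: "\<exists>U. openin tower_space U \<and> openin tower_space (- U) \<and> (x \<in> U \<longleftrightarrow> y \<notin> U)"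
    if xy: "x \<noteq> y" for x y :: "nat + 'i option"
  proof -
    consider n where "x = Inl n" | n where "y = Inl n" | p q where "x = Inr p" "y = Inr q"
      by (meson sum.exhaust)
    then show ?thesis
    proof cases
      case 1
      then show ?thesis
        using openin_isolated[of n] xy by (intro exI[of _ "{Inl n}"]) auto
    next
      case 2
      then show ?thesis
        using openin_isolated[of n] xy by (intro exI[of _ "{Inl n}"]) auto
    next
      case 3
      \<comment> \<open>The block of the smaller index contains that point and not the larger one;
        the top lies in no block.\<close>
      have "\<exists>a. Inr p \<in> block a \<longleftrightarrow> Inr q \<notin> block a"
      proof (cases p)
        case None
        then obtain c where "q = Some c"
          using xy 3 by (cases q) auto
        then show ?thesis
          using None refl_r Field_UNIV by (auto simp: Inr_in_block)
      next
        case (Some c)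
        show ?thesis
        proof (cases q)
          case None
          then show ?thesis
            using Some refl_r Field_UNIV by (auto simp: Inr_in_block)
        next
          case (Some d)
          have "c \<noteq> d"
            using \<open>p = Some c\<close> Some xy 3 by auto
          then have "\<not> ((c, d) \<in> r \<and> (d, c) \<in> r)"
            using antisym_r by blast
          then show ?thesis
            using \<open>p = Some c\<close> Some refl_r Field_UNIV by (auto simp: Inr_in_block)
        qed
      qed
      then show ?thesis
        using openin_block openin_Compl_block 3 by metis
    qed
  qed
  show ?thesis
    unfolding Hausdorff_space_def
  proof (intro allI impI)
    fix x y assume "x \<in> topspace tower_space \<and> y \<in> topspace tower_space \<and> x \<noteq> y"
    then obtain U where "openin tower_space U" "openin tower_space (- U)" "x \<in> U \<longleftrightarrow> y \<notin> U"
      using clopen by blast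
    then show "\<exists>U V. openin tower_space U \<and> openin tower_space V \<and> x \<in> U \<and> y \<in> V \<and> disjnt U V"
      by (cases "x \<in> U") (auto intro: exI[of _ U] exI[of _ "- U"] simp: disjnt_def)
  qed
qed

text \<open>Well-founded induction: one member of the cover around \<open>Inr p\<close> leaves of
  \<open>seg p\<close> only finitely many naturals and finitely many earlier blocks, which are
  already finitely covered.\<close>

lemma compact_tower_space: "compact_space tower_space"
  unfolding compact_space_alt topspace_tower_space
proof (intro allI impI)
  fix \<U> assume "(\<forall>U\<in>\<U>. openin tower_space U) \<and> UNIV \<subseteq> \<Union>\<U>"
  then have open_U: "\<And>U. U \<in> \<U> \<Longrightarrow> tower_open U" and cover: "\<And>x. \<exists>U\<in>\<U>. x \<in> U"
    unfolding openin_tower_space by blast+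
  have step: "\<exists>\<V>. finite \<V> \<and> \<V> \<subseteq> \<U> \<and> seg p \<subseteq> \<Union>\<V>"
    if IH: "\<And>b. b \<in> preds p \<Longrightarrow> \<exists>\<V>. finite \<V> \<and> \<V> \<subseteq> \<U> \<and> block b \<subseteq> \<Union>\<V>" for p
  proof -
    obtain U where U: "U \<in> \<U>" "Inr p \<in> U"
      using cover by blast
    obtain B k where B: "finite B" "B \<subseteq> preds p" "finite k" "seg p - (\<Union>b\<in>B. block b) - Inl ` k \<subseteq> U"
      using open_U[OF U(1)] U(2) unfolding tower_open_def by metis
    have "\<forall>b\<in>B. \<exists>\<V>. finite \<V> \<and> \<V> \<subseteq> \<U> \<and> block b \<subseteq> \<Union>\<V>"
      using IH B(2) by auto
    then obtain V where V: "\<And>b. b \<in> B \<Longrightarrow> finite (V b) \<and> V b \<subseteq> \<U> \<and> block b \<subseteq> \<Union>(V b)"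
      by metis
    have "\<forall>n. \<exists>U. U \<in> \<U> \<and> Inl n \<in> U"
      using cover by blast
    then obtain W where W: "\<And>n. W n \<in> \<U> \<and> Inl n \<in> W n"
      by metis
    let ?V = "insert U ((\<Union>b\<in>B. V b) \<union> W ` k)"
    have "finite ?V"
      using B V by simp
    moreover have "?V \<subseteq> \<U>"
      using U(1) V W by auto
    moreover have "seg p \<subseteq> \<Union>?V"
    proof
      fix z assume z: "z \<in> seg p"
      consider "z \<in> U" | b where "b \<in> B" "z \<in> block b" | n where "n \<in> k" "z = Inl n"
        using z B(4) by blast
      then show "z \<in> \<Union>?V"
      proof cases
        case 2
        then have "z \<in> \<Union>(V b)"
          using V by blast
        then show ?thesis
          using 2(1) by blast
      next
        case 3
        then have "W n \<in> ?V" "z \<in> W n"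
          using W by auto
        then show ?thesis
          by blast
      qed blast
    qed
    ultimately show ?thesis
      by metis
  qed
  have blocks: "\<exists>\<V>. finite \<V> \<and> \<V> \<subseteq> \<U> \<and> block a \<subseteq> \<Union>\<V>" for a
  proof (induction a rule: wf_induct_rule[OF wf_r])
    case (1 a)
    have "\<exists>\<V>. finite \<V> \<and> \<V> \<subseteq> \<U> \<and> seg (Some a) \<subseteq> \<Union>\<V>"
      by (rule step) (use 1 in \<open>simp add: preds_def underS_def\<close>)
    then show ?case
      by (simp add: seg_def)
  qed
  have "\<exists>\<V>. finite \<V> \<and> \<V> \<subseteq> \<U> \<and> seg None \<subseteq> \<Union>\<V>"
    by (rule step) (rule blocks)
  then show "\<exists>\<V>. finite \<V> \<and> \<V> \<subseteq> \<U> \<and> UNIV \<subseteq> \<Union>\<V>"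
    by (simp add: seg_def)
qed

lemma separable_tower_space: "separable_space tower_space"
  unfolding separable_space_def
proof (intro exI[of _ "range Inl"] conjI)
  show "tower_space closure_of range Inl = topspace tower_space"
    unfolding dense_intersects_open
  proof (intro allI impI)
    fix U assume "openin tower_space U \<and> U \<noteq> {}"
    then obtain z where U: "tower_open U" "z \<in> U"
      unfolding openin_tower_space by blast
    show "range Inl \<inter> U \<noteq> {}"
    proof (cases z)
      case (Inr p)
      then obtain B k where B: "finite B" "B \<subseteq> preds p" "finite k" "seg p - (\<Union>b\<in>B. block b) - Inl ` k \<subseteq> U"
        using U unfolding tower_open_def by metis
      \<comment> \<open>The trace of \<open>seg p\<close> on \<omega>; it stays infinite after
        removing finitely many earlier sets of the almost chain and then \<open>k\<close>.\<close>
      define Y where "Y = (case p of None \<Rightarrow> UNIV | Some a \<Rightarrow> T a)"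
      have Y: "infinite Y" "\<And>b. b \<in> preds p \<Longrightarrow> infinite (Y - T b)" "Inl ` Y \<subseteq> seg p"
        unfolding Y_def preds_def seg_def using infinite_T coinfinite_T T_strict
        by (auto split: option.splits simp: Inl_in_block Compl_eq_Diff_UNIV)
      have "infinite (Y - (\<Union>b\<in>B. T b))"
        using B Y T_chain by (intro infinite_Diff_almost_chain) auto
      then have "infinite (Y - (\<Union>b\<in>B. T b) - k)"
        using B(3) by (rule Diff_infinite_finite[rotated])
      then obtain n where n: "n \<in> Y - (\<Union>b\<in>B. T b) - k"
        by (metis finite.emptyI ex_in_conv)
      then have "Inl n \<in> seg p - (\<Union>b\<in>B. block b) - Inl ` k"
        using Y(3) by (auto simp: Inl_in_block)
      then show ?thesis
        using B(4) by blast
    qed (use U in auto)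
  qed
qed (auto simp: topspace_tower_space)

end

section \<open>The tower space under the Continuum Hypothesis\<close>

context partition_regular_function
begin

text \<open>The surjection \<open>q\<close> codes every relation between \<open>\<Lambda>\<close>
  and \<omega> at some index, and stage \<open>a\<close> takes care of the relation coded by
  \<open>q a\<close>.\<close>

lemma tower_exists:
  fixes r :: "'i rel" and q :: "'i \<Rightarrow> nat set"
  assumes r: "omega1_order r" and Field: "Field r = UNIV" and q: "surj q"
  obtains T where "tower r T"
    "\<And>R. pos {l \<in> \<Lambda>. \<exists>k. R l k} \<Longrightarrow> \<exists>a. pos {l \<in> \<Lambda>. \<exists>k\<in>T a. R l k}"
proof -
  interpret omega1_order r by fact
  \<comment> \<open>The points of \<open>\<Lambda>\<close> that the relation coded by
    \<open>q a\<close> connects with an element of \<open>t\<close>; \<open>S a UNIV\<close> is its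
    whole domain.\<close>
  define S where "S a t = {l \<in> \<Lambda>. \<exists>k\<in>t. prod_encode (to_nat_on \<Lambda> l, k) \<in> q a}" for a t
  define good where "good f a t \<longleftrightarrow> infinite t \<and> infinite (- t) \<and>
    (\<forall>b. (b, a) \<in> r - Id \<longrightarrow> finite (f b - t) \<and> infinite (t - f b)) \<and>
    (pos (S a UNIV) \<longrightarrow> pos (S a t))" for f :: "'i \<Rightarrow> nat set" and a t
  have "\<exists>T. \<forall>a. good T a (T a)"
  proof (rule dependent_wf_choice[OF wf_r])
    show "good f a t = good g a t" if "\<And>b. (b, a) \<in> r - Id \<Longrightarrow> f b = g b" for f g a t
      using that unfolding good_def by auto
    fix a f assume IH: "\<And>b. (b, a) \<in> r - Id \<Longrightarrow> good f b (f b)"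
    have below: "(b, a) \<in> r - Id \<longleftrightarrow> b \<in> underS r a" for b
      by (auto simp: underS_def)
    have coinf: "infinite (- f b)" if "b \<in> underS r a" for b
      using IH[of b] that unfolding below good_def by blast
    have chain: "finite (f b - f c) \<or> finite (f c - f b)"
      if bc: "b \<in> underS r a" "c \<in> underS r a" for b c
    proof -
      consider "b = c" | "(b, c) \<in> r - Id" | "(c, b) \<in> r - Id"
        using total_r[of b c] Field by auto
      then show ?thesis
      proof cases
        case 2
        then show ?thesis
          using IH[of c] bc unfolding below good_def by blast
      next
        case 3
        then show ?thesis
          using IH[of b] bc unfolding below good_def by blast
      qed simp
    qed
    have "countable (underS r a)"
      using countable_underS[of a] Field by simp
    from almost_chain_split[where f = f, OF this coinf chain] obtain P Q where PQ: "infinite P" "infinite Q" "P \<inter> Q = {}"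
      "\<And>b. b \<in> underS r a \<Longrightarrow> finite (P \<inter> f b)" "\<And>b. b \<in> underS r a \<Longrightarrow> finite (Q \<inter> f b)"
      by metis
    \<comment> \<open>The set \<open>W\<close> lies in \<open>- V\<close> and meets each earlier set
      finitely, so \<open>- V\<close> exceeds all of them infinitely; the infinite \<open>V\<close>
      keeps the complement infinite.\<close>
    have claim: "good f a (- V)"
      if V: "infinite V" and W: "infinite W" "V \<inter> W = {}"
        and fin: "\<And>b. b \<in> underS r a \<Longrightarrow> finite (V \<inter> f b)" "\<And>b. b \<in> underS r a \<Longrightarrow> finite (W \<inter> f b)"
        and p: "pos (S a UNIV) \<longrightarrow> pos (S a (- V))" for V W
    proof -
      have WV: "W \<subseteq> - V"
        using W(2) by blast
      have "finite (f b - - V)" "infinite (- V - f b)" if b: "b \<in> underS r a" for b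
      proof -
        have "f b - - V = V \<inter> f b"
          by blast
        then show "finite (f b - - V)"
          using fin(1)[OF b] by simp
        have "infinite (W - W \<inter> f b)"
          using fin(2)[OF b] W(1) by (rule Diff_infinite_finite)
        moreover have "W - W \<inter> f b \<subseteq> - V - f b"
          using WV by blast
        ultimately show "infinite (- V - f b)"
          using finite_subset by blast
      qed
      moreover have "infinite (- V)"
        using W(1) WV finite_subset by blast
      ultimately show ?thesis
        unfolding good_def below using V p by simp
    qed
    have "S a UNIV \<subseteq> S a (- P) \<union> S a (- Q)"
      unfolding S_def using PQ(3) by auto
    then have "pos (S a UNIV) \<longrightarrow> pos (S a (- P)) \<or> pos (S a (- Q))"
      using pos_Un pos_mono by metis
    then consider "pos (S a UNIV) \<longrightarrow> pos (S a (- P))" | "pos (S a UNIV) \<longrightarrow> pos (S a (- Q))"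
      by blast
    then show "\<exists>t. good f a t"
    proof cases
      case 1
      then show ?thesis
        using claim[of P Q] PQ by blast
    next
      case 2
      then show ?thesis
        using claim[of Q P] PQ by (metis Int_commute)
    qed
  qed
  then obtain T where T: "\<And>a. good T a (T a)"
    by blast
  have "tower r T"
  proof
    show "Field r = UNIV"
      by fact
    show "infinite (T a)" "infinite (- T a)" for a
      using T[of a] unfolding good_def by blast+
    show "finite (T b - T a)" "infinite (T a - T b)" if "b \<in> underS r a" for a b
      using T[of a] that unfolding good_def underS_def by blast+
  qed
  moreover have "\<exists>a. pos {l \<in> \<Lambda>. \<exists>k\<in>T a. R l k}" if R: "pos {l \<in> \<Lambda>. \<exists>k. R l k}" for R
  proof -
    define Z where "Z = {prod_encode (to_nat_on \<Lambda> l, k) | l k. l \<in> \<Lambda> \<and> R l k}"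
    obtain a where a: "q a = Z"
      using surjD[OF q, of Z] by metis
    have "prod_encode (to_nat_on \<Lambda> l, k) \<in> q a \<longleftrightarrow> R l k" if "l \<in> \<Lambda>" for l k
      unfolding a Z_def using that countable_Lambda by (auto simp: to_nat_on_inj)
    then have S: "S a t = {l \<in> \<Lambda>. \<exists>k\<in>t. R l k}" for t
      unfolding S_def by blast
    have "pos (S a (T a))"
      using T[of a] R unfolding good_def by (simp add: S)
    then show ?thesis
      unfolding S by blast
  qed
  ultimately show thesis
    using that by blast
qed

text \<open>With all fibres null, the limit is the least index whose block has positive preimage;
  below it only countably many blocks have to be escaped.\<close>

lemma P_minus_tower_space:
  fixes r :: "'i rel"
  assumes P: "P_minus \<Lambda> \<Omega> \<F> \<rho>" and tower: "tower r T"
    and catch: "\<And>R. pos {l \<in> \<Lambda>. \<exists>k. R l k} \<Longrightarrow> \<exists>a. pos {l \<in> \<Lambda>. \<exists>k\<in>T a. R l k}"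
  shows "BW_on \<Lambda> (tower.tower_space r T)"
  unfolding BW_on_def
proof
  interpret tower r T by fact
  fix f :: "'l \<Rightarrow> nat + 'i option"
  show "\<exists>F\<in>\<F>. \<rho> F \<subseteq> \<Lambda> \<and> (\<exists>x. rho_convergent_to \<Omega> \<rho> tower_space F f x)"
  proof (cases "\<exists>z. pos {l \<in> \<Lambda>. f l = z}")
    case True
    then show ?thesis
      using rho_convergent_constant[of \<Lambda> f _ tower_space] topspace_tower_space by blast
  next
    case False
    define D where "D a = {l \<in> \<Lambda>. f l \<in> block a}" for a
    \<comment> \<open>If values in \<omega> are taken on a positive set, \<open>catch\<close>
      supplies the block; if values below the top are, they are countably many and hence bounded.
      The fibre of the top is null here.\<close>
    have "\<exists>c. pos (D c)"
    proof -
      let ?A = "{l \<in> \<Lambda>. \<exists>k. f l = Inl k}" and ?B = "{l \<in> \<Lambda>. \<exists>a. f l = Inr (Some a)}"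
      have "\<Lambda> \<subseteq> ?A \<union> (?B \<union> {l \<in> \<Lambda>. f l = Inr None})"
      proof
        fix l assume "l \<in> \<Lambda>"
        then show "l \<in> ?A \<union> (?B \<union> {l \<in> \<Lambda>. f l = Inr None})"
          by (cases "f l"; cases "projr (f l)") auto
      qed
      then have "pos (?A \<union> (?B \<union> {l \<in> \<Lambda>. f l = Inr None}))"
        by (rule pos_mono[OF pos_Lambda])
      then have "pos ?A \<or> pos ?B \<or> pos {l \<in> \<Lambda>. f l = Inr None}"
        by (auto dest!: pos_Un)
      then consider "pos ?A" | "pos ?B"
        using False by blast
      then show ?thesis
      proof cases
        case 1
        then obtain a where "pos {l \<in> \<Lambda>. \<exists>k\<in>T a. f l = Inl k}"
          using catch[of "\<lambda>l k. f l = Inl k"] by blast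
        moreover have "{l \<in> \<Lambda>. \<exists>k\<in>T a. f l = Inl k} \<subseteq> D a"
          unfolding D_def by (auto simp: Inl_in_block)
        ultimately show ?thesis
          using pos_mono by blast
      next
        case 2
        let ?N = "(\<lambda>l. the (projr (f l))) ` ?B"
        have "countable ?N"
          using countable_Lambda by (intro countable_image countable_Collect) auto
        then obtain c where c: "\<And>a. a \<in> ?N \<Longrightarrow> (a, c) \<in> r"
          using countable_bounded[of ?N] Field_UNIV by blast
        have "?B \<subseteq> D c"
        proof
          fix l assume l: "l \<in> ?B"
          then obtain a where a: "f l = Inr (Some a)"
            by blast
          have "a \<in> ?N"
            using l a by (intro image_eqI[of _ _ l]) auto
          then show "l \<in> D c"
            using c l a unfolding D_def by (auto simp: Inr_in_block)
        qed
        then show ?thesis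
          using 2 pos_mono by blast
      qed
    qed
    then obtain c where "pos (D c)" ..
    then obtain a where a: "pos (D a)" and least: "\<And>b. b \<in> underS r a \<Longrightarrow> \<not> pos (D b)"
      using least_r[of c "\<lambda>a. pos (D a)"] Field_UNIV by auto
    \<comment> \<open>The fibres over single naturals must be escaped as well, since neighbourhoods
      may omit finitely many naturals.\<close>
    define E where "E n = {l \<in> \<Lambda>. f l = Inl n}" for n
    have "D a \<subseteq> \<Lambda>"
      unfolding D_def by blast
    then have "diagonal (D a)"
      using P a unfolding P_minus_iff by simp
    moreover have "countable (D ` underS r a \<union> range E)"
      using countable_underS[of a] Field_UNIV by simp
    moreover have "\<not> pos (D a \<inter> C)" if "C \<in> D ` underS r a \<union> range E" for C
    proof -
      have "\<not> pos C"
        using that least False unfolding E_def by blast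
      then show ?thesis
        using pos_mono[of "D a \<inter> C" C] by blast
    qed
    ultimately obtain F where F: "F \<in> \<F>" "\<rho> F \<subseteq> D a"
      and esc: "\<And>\<D>. finite \<D> \<Longrightarrow> \<D> \<subseteq> D ` underS r a \<union> range E \<Longrightarrow>
        \<exists>K. finite K \<and> K \<subseteq> \<Omega> \<and> \<rho> (F - K) \<inter> \<Union>\<D> = {}"
      using diagonal_countable by metis
    have "rho_convergent_to \<Omega> \<rho> tower_space F f (Inr (Some a))"
      unfolding rho_convergent_to_def
    proof (intro conjI allI impI)
      fix U assume "openin tower_space U \<and> Inr (Some a) \<in> U"
      then obtain B k where B: "finite B" "B \<subseteq> preds (Some a)" "finite k"
        "seg (Some a) - (\<Union>b\<in>B. block b) - Inl ` k \<subseteq> U"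
        unfolding openin_tower_space tower_open_def by metis
      have "D ` B \<union> E ` k \<subseteq> D ` underS r a \<union> range E"
        using B(2) unfolding preds_def by auto
      then obtain K where K: "finite K" "K \<subseteq> \<Omega>" "\<rho> (F - K) \<inter> \<Union>(D ` B \<union> E ` k) = {}"
        using esc[of "D ` B \<union> E ` k"] B(1,3) by auto
      have "f l \<in> U" if l: "l \<in> \<rho> (F - K)" for l
      proof -
        have "l \<in> D a"
          using l rho_Diff_subset[OF F(1) K(1,2)] F(2) by blast
        then have "l \<in> \<Lambda>" "f l \<in> seg (Some a)"
          unfolding D_def seg_def by auto
        moreover have "l \<notin> \<Union>(D ` B \<union> E ` k)"
          using l K(3) by blast
        ultimately have "f l \<in> seg (Some a) - (\<Union>b\<in>B. block b) - Inl ` k"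
          unfolding D_def E_def by blast
        then show ?thesis
          using B(4) by blast
      qed
      then show "\<exists>K. finite K \<and> K \<subseteq> \<Omega> \<and> f ` \<rho> (F - K) \<subseteq> U"
        using K(1,2) by (metis image_subsetI)
    qed (simp add: topspace_tower_space)
    then show ?thesis
      using F(1) rho_subset[OF F(1)] by metis
  qed
qed

end

lemma tower_points_eqpoll_reals: "(UNIV :: (nat + real option) set) \<approx> (UNIV :: real set)"
proof (rule lepoll_antisym)
  have "(UNIV :: real set) \<lesssim> {0<..<1 :: real}"
    using open_interval_eqpoll_reals[of 0 1] by (simp add: eqpoll_imp_lepoll eqpoll_sym)
  then obtain j :: "real \<Rightarrow> real" where j: "inj j" "\<And>x. 0 < j x \<and> j x < 1"
    unfolding lepoll_def by (auto simp: image_subset_iff)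
  \<comment> \<open>The three kinds of points get disjoint ranges: naturals go to at least 1, the
    top to 0, and the indices strictly between.\<close>
  define h :: "nat + real option \<Rightarrow> real" where
    "h z = (case z of Inl n \<Rightarrow> real n + 1 | Inr None \<Rightarrow> 0 | Inr (Some x) \<Rightarrow> j x)" for z
  have neq: "real n + 1 \<noteq> j x" "real n + 1 \<noteq> 0" "j x \<noteq> 0" for n x
    using j(2)[of x] by auto
  have "inj h"
  proof (rule injI)
    fix y z assume "h y = h z"
    then show "y = z"
      unfolding h_def
      by (simp add: neq neq[symmetric] inj_eq[OF j(1)] split: sum.splits option.splits)
  qed
  then show "(UNIV :: (nat + real option) set) \<lesssim> (UNIV :: real set)"
    unfolding lepoll_def by blast
  have "inj (\<lambda>x :: real. (Inr (Some x) :: nat + real option))"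
    by (auto simp: inj_def)
  then show "(UNIV :: real set) \<lesssim> (UNIV :: (nat + real option) set)"
    unfolding lepoll_def by blast
qed

lemma homeomorphic_space_imp_eqpoll:
  assumes "X homeomorphic_space Y"
  shows "topspace X \<approx> topspace Y"
proof (rule lepoll_antisym)
  obtain h where "h ` topspace Y = topspace X"
    using assms homeomorphic_space_sym homeomorphic_space_surjective_map by metis
  then show "topspace X \<lesssim> topspace Y"
    using image_lepoll by metis
  obtain g where "g ` topspace X = topspace Y"
    using assms homeomorphic_space_surjective_map by metis
  then show "topspace Y \<lesssim> topspace X"
    using image_lepoll by metis
qed

text \<open>The reals serve as index set in two ways: under the Continuum Hypothesis their cardinal
  order has type \<open>\<omega>\<^sub>1\<close>, and they map onto the sets of naturals that code
  all relations.\<close>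

lemma (in partition_regular_function) P_minus_separable_compact:
  assumes P: "P_minus \<Lambda> \<Omega> \<F> \<rho>" and CH: "continuum_hypothesis"
  shows "\<exists>X :: real topology. topspace X \<approx> (UNIV :: real set) \<and> Hausdorff_space X \<and>
    compact_space X \<and> separable_space X \<and> X \<in> FinBW \<Lambda> \<Omega> \<F> \<rho>"
proof -
  let ?r = "card_of (UNIV :: real set)"
  have "(UNIV :: real set) \<approx> (UNIV :: nat set set)"
    using nat_sets_eqpoll_reals eqpoll_sym by blast
  then obtain q :: "real \<Rightarrow> nat set" where "surj q"
    unfolding eqpoll_def bij_betw_def by blast
  then obtain T where T: "tower ?r T"
    and catch: "\<And>R. pos {l \<in> \<Lambda>. \<exists>k. R l k} \<Longrightarrow> \<exists>a. pos {l \<in> \<Lambda>. \<exists>k\<in>T a. R l k}"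
    using tower_exists[OF omega1_order_reals[OF CH] Field_card_of] by blast
  interpret tower ?r T by fact
  have BW: "BW_on \<Lambda> tower_space"
    using P_minus_tower_space[OF P T catch] .
  have "topspace tower_space \<lesssim> (UNIV :: real set)"
    using tower_points_eqpoll_reals unfolding topspace_tower_space by (rule eqpoll_imp_lepoll)
  then obtain X :: "real topology" where X: "tower_space homeomorphic_space X"
    using homeomorphic_copy by blast
  have "topspace X \<approx> (UNIV :: real set)"
    using homeomorphic_space_imp_eqpoll[OF X] tower_points_eqpoll_reals
    unfolding topspace_tower_space by (meson eqpoll_sym eqpoll_trans)
  moreover have "Hausdorff_space X" "compact_space X" "separable_space X"
    using homeomorphic_Hausdorff_space[OF X] homeomorphic_compact_space[OF X]
      homeomorphic_separable_space[OF X] Hausdorff_tower_space compact_tower_space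
      separable_tower_space by auto
  moreover have "BW_on \<Lambda> X"
    using BW X homeomorphic_space_surjective_map BW_on_continuous_map_image by metis
  ultimately show ?thesis
    unfolding FinBW_iff by blast
qed

text \<open>The classes are compared at a point type \<open>'a\<close>, hence the size conditions:
  room for a Mrowka space in the tall case, and an infinite type where infinite spaces are sought.
  Arbitrary cardinality means that of any \<open>A :: 'a set\<close>.\<close>

theorem theorem10p5:
  fixes \<Lambda> :: "'l set" and \<Omega> :: "'o set" and \<F> :: "'o set set"
    and \<rho> :: "'o set \<Rightarrow> 'l set"
  assumes "partition_regular \<Lambda> \<Omega> \<F> \<rho>"
  shows
    "({X :: 'a topology. finite (topspace X)} \<subseteq> FinBW \<Lambda> \<Omega> \<F> \<rho> \<and>
      FinBW \<Lambda> \<Omega> \<F> \<rho> \<subseteq> {X :: 'a topology. sequentially_compact_space X})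
     \<and>
     ((\<not> tall \<Lambda> \<F> \<rho> \<longrightarrow>
        FinBW \<Lambda> \<Omega> \<F> \<rho> = {X :: 'a topology. sequentially_compact_space X}) \<and>
      ((UNIV :: real set) \<lesssim> (UNIV :: 'a set) \<longrightarrow>
        (\<not> tall \<Lambda> \<F> \<rho> \<longleftrightarrow>
         FinBW \<Lambda> \<Omega> \<F> \<rho> = {X :: 'a topology. sequentially_compact_space X})))
     \<and>
     (infinite (UNIV :: 'a set) \<longrightarrow>
       (P_minus_Lambda \<Lambda> \<Omega> \<F> \<rho> \<longleftrightarrow>
        (\<forall>A :: 'a set. \<exists>X :: 'a topology. topspace X \<approx> A \<and> Hausdorff_space X \<and>
           compact_space X \<and> X \<in> FinBW \<Lambda> \<Omega> \<F> \<rho>)) \<and>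
       (P_minus_Lambda \<Lambda> \<Omega> \<F> \<rho> \<longleftrightarrow>
        (\<exists>X :: 'a topology. infinite (topspace X) \<and> Hausdorff_space X \<and>
           X \<in> FinBW \<Lambda> \<Omega> \<F> \<rho>)))
     \<and>
     (infinite (UNIV :: 'a set) \<longrightarrow>
       (P_minus \<Lambda> \<Omega> \<F> \<rho> \<longleftrightarrow>
        (\<forall>A :: 'a set. \<exists>X :: 'a topology. topspace X \<approx> A \<and> Hausdorff_space X \<and>
           compact_space X \<and> X \<in> hFinBW \<Omega> \<F> \<rho>)) \<and>
       (P_minus \<Lambda> \<Omega> \<F> \<rho> \<longleftrightarrow>
        (\<exists>X :: 'a topology. infinite (topspace X) \<and> Hausdorff_space X \<and>
           X \<in> hFinBW \<Omega> \<F> \<rho>)))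
     \<and>
     (P_minus \<Lambda> \<Omega> \<F> \<rho> \<longrightarrow>
       (uncountable (topspace omega1_space) \<and> \<not> compact_space omega1_space \<and>
        Hausdorff_space omega1_space \<and> omega1_space \<in> FinBW \<Lambda> \<Omega> \<F> \<rho>) \<and>
       (continuum_hypothesis \<longrightarrow>
        (\<exists>X :: real topology. topspace X \<approx> (UNIV :: real set) \<and> Hausdorff_space X \<and>
           compact_space X \<and> separable_space X \<and> X \<in> FinBW \<Lambda> \<Omega> \<F> \<rho>)))
     \<and>
     (weak_P_plus \<Omega> \<F> \<rho> \<longrightarrow>
       (\<forall>m :: 'a metric. compact_space (mtopology_of m) \<longrightarrow>
          mtopology_of m \<in> hFinBW \<Omega> \<F> \<rho>))
     \<and>
     (P_plus \<Lambda> \<Omega> \<F> \<rho> \<longrightarrow>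
       (\<forall>X :: 'a topology. Hausdorff_space X \<and> property_star X \<longrightarrow>
          X \<in> hFinBW \<Omega> \<F> \<rho>))"
proof -
  interpret partition_regular_function \<Lambda> \<Omega> \<F> \<rho>
    by unfold_locales fact
  have one: "{X :: 'a topology. finite (topspace X)} \<subseteq> FinBW \<Lambda> \<Omega> \<F> \<rho>"
    "FinBW \<Lambda> \<Omega> \<F> \<rho> \<subseteq> {X :: 'a topology. sequentially_compact_space X}"
    using finite_in_FinBW FinBW_imp_sequentially_compact by auto
  have not_tall: "FinBW \<Lambda> \<Omega> \<F> \<rho> = {X :: 'a topology. sequentially_compact_space X}"
    if "\<not> tall \<Lambda> \<F> \<rho>"
    using one(2) not_tall_imp_FinBW[OF that] by auto
  have tall: "FinBW \<Lambda> \<Omega> \<F> \<rho> \<noteq> {X :: 'a topology. sequentially_compact_space X}"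
    if "tall \<Lambda> \<F> \<rho>" "(UNIV :: real set) \<lesssim> (UNIV :: 'a set)"
    using tall_imp_sequentially_compact_not_FinBW[OF that] by auto
  have three: "P_minus_Lambda \<Lambda> \<Omega> \<F> \<rho> \<longleftrightarrow>
      (\<forall>A :: 'a set. \<exists>X :: 'a topology. topspace X \<approx> A \<and> Hausdorff_space X \<and>
         compact_space X \<and> X \<in> FinBW \<Lambda> \<Omega> \<F> \<rho>)" (is "_ \<longleftrightarrow> ?b")
    "P_minus_Lambda \<Lambda> \<Omega> \<F> \<rho> \<longleftrightarrow>
      (\<exists>X :: 'a topology. infinite (topspace X) \<and> Hausdorff_space X \<and>
         X \<in> FinBW \<Lambda> \<Omega> \<F> \<rho>)" (is "_ \<longleftrightarrow> ?c")
    if inf: "infinite (UNIV :: 'a set)"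
  proof -
    have "?b" if "P_minus_Lambda \<Lambda> \<Omega> \<F> \<rho>"
      using P_minus_Lambda_imp_compact_Hausdorff[OF that] by blast
    moreover have "?c" if "?b"
      using spec[OF that, of UNIV] inf eqpoll_finite_iff by blast
    moreover have "P_minus_Lambda \<Lambda> \<Omega> \<F> \<rho>" if "?c"
      using that infinite_Hausdorff_FinBW_imp_P_minus_Lambda by blast
    ultimately show "P_minus_Lambda \<Lambda> \<Omega> \<F> \<rho> \<longleftrightarrow> ?b" "P_minus_Lambda \<Lambda> \<Omega> \<F> \<rho> \<longleftrightarrow> ?c"
      by argo+
  qed
  have four: "P_minus \<Lambda> \<Omega> \<F> \<rho> \<longleftrightarrow>
      (\<forall>A :: 'a set. \<exists>X :: 'a topology. topspace X \<approx> A \<and> Hausdorff_space X \<and>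
         compact_space X \<and> X \<in> hFinBW \<Omega> \<F> \<rho>)" (is "_ \<longleftrightarrow> ?b")
    "P_minus \<Lambda> \<Omega> \<F> \<rho> \<longleftrightarrow>
      (\<exists>X :: 'a topology. infinite (topspace X) \<and> Hausdorff_space X \<and>
         X \<in> hFinBW \<Omega> \<F> \<rho>)" (is "_ \<longleftrightarrow> ?c")
    if inf: "infinite (UNIV :: 'a set)"
  proof -
    have "?b" if "P_minus \<Lambda> \<Omega> \<F> \<rho>"
      using P_minus_imp_compact_Hausdorff[OF that] by blast
    moreover have "?c" if "?b"
      using spec[OF that, of UNIV] inf eqpoll_finite_iff by blast
    moreover have "P_minus \<Lambda> \<Omega> \<F> \<rho>" if "?c"
      using that infinite_Hausdorff_hFinBW_imp_P_minus by blast
    ultimately show "P_minus \<Lambda> \<Omega> \<F> \<rho> \<longleftrightarrow> ?b" "P_minus \<Lambda> \<Omega> \<F> \<rho> \<longleftrightarrow> ?c"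
      by argo+
  qed
  interpret omega1: omega1_order "cardSuc natLeq"
    by (rule omega1_order_cardSuc_natLeq)
  have five: "uncountable (topspace omega1_space)" "\<not> compact_space omega1_space"
    "Hausdorff_space omega1_space"
    "P_minus \<Lambda> \<Omega> \<F> \<rho> \<Longrightarrow> omega1_space \<in> FinBW \<Lambda> \<Omega> \<F> \<rho>"
    unfolding omega1_space_def
    using omega1.topspace_order_topology omega1.uncountable_Field omega1.not_compact_order_topology
      omega1.Hausdorff_order_topology P_minus_order_topology[OF _ omega1_order_cardSuc_natLeq]
    by simp_all
  have tall_iff: "\<not> tall \<Lambda> \<F> \<rho> \<longleftrightarrow>
      FinBW \<Lambda> \<Omega> \<F> \<rho> = {X :: 'a topology. sequentially_compact_space X}"
    if "(UNIV :: real set) \<lesssim> (UNIV :: 'a set)"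
    using not_tall tall[OF _ that] by argo
  show ?thesis
    by (intro conjI impI allI; (elim conjE)?;
        (rule one not_tall tall_iff three four five P_minus_separable_compact
          weak_P_plus_compact_metric P_plus_property_star; assumption))
qed

end
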